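(* $\boldsymbol{\mathcal{V}}(\mathsf{hypo})$ is the varietal join $\boldsymbol{\mathcal{V}}(\mathsf{styl}_2)\vee\boldsymbol{\mathcal{C}}$, and is generated by $\mathsf{styl}_2$ and the free commutative monoid.
   Context: $\mathsf{styl}_2$, the stylic monoid of rank $2$, is the monoid presented by generators $\{1<2\}$ and relations $acb=cab$ (for $a\le b<c$), $bac=bca$ (for $a<b\le c$), and $a^2=a$, where $a,b,c\in\{1,2\}$. The hypoplactic monoid $\mathsf{hypo}$ (of infinite rank) is the monoid presented by generators $\mathbb{N}=\{1<2<3<\cdots\}$ and relations $acb=cab$ ($a\le b<c$), $bac=bca$ ($a<b\le c$), $cadb=acbd$ ($a\le b<c\le d$), $bdac=dbca$ ($a<b\le c<d$). A variety is a class of monoids closed under homomorphic images, submonoids and direct products; $\boldsymbol{\mathcal{V}}(M)$ is the variety generated by $M$; $\boldsymbol{\mathcal{C}}$ is the variety of all commutative monoids; the varietal join $\boldsymbol{\mathcal{U}}\vee\boldsymbol{\mathcal{W}}$ is the smallest variety containing both $\boldsymbol{\mathcal{U}}$ and $\boldsymbol{\mathcal{W}}$. The free commutative monoid is taken on the countably infinite set $\mathbb{N}$. *)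

theory Defs
  imports "HOL-Algebra.Product_Groups" "HOL-Library.Multiset" "HOL-Library.Infinite_Typeclass"
    "HOL-Library.Countable_Set"
begin

section \<open>Monoids given by presentations\<close>

text \<open>The least congruence on the free monoid \<open>lists A\<close> containing \<open>R\<close>.\<close>

inductive_set presentation_cong :: "'a set \<Rightarrow> ('a list \<times> 'a list) set \<Rightarrow> ('a list \<times> 'a list) set"
  for A :: "'a set" and R :: "('a list \<times> 'a list) set" where
  rel: "\<lbrakk>(u, v) \<in> R; u \<in> lists A; v \<in> lists A\<rbrakk> \<Longrightarrow> (u, v) \<in> presentation_cong A R"
| refl: "u \<in> lists A \<Longrightarrow> (u, u) \<in> presentation_cong A R"
| sym: "(u, v) \<in> presentation_cong A R \<Longrightarrow> (v, u) \<in> presentation_cong A R"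
| trans: "\<lbrakk>(u, v) \<in> presentation_cong A R; (v, w) \<in> presentation_cong A R\<rbrakk>
    \<Longrightarrow> (u, w) \<in> presentation_cong A R"
| append: "\<lbrakk>(u, v) \<in> presentation_cong A R; (u', v') \<in> presentation_cong A R\<rbrakk>
    \<Longrightarrow> (u @ u', v @ v') \<in> presentation_cong A R"

definition presented_monoid :: "'a set \<Rightarrow> ('a list \<times> 'a list) set \<Rightarrow> 'a list set monoid" where
  "presented_monoid A R =
    \<lparr>carrier = lists A // presentation_cong A R,
     monoid.mult = (\<lambda>X Y. \<Union>x\<in>X. \<Union>y\<in>Y. presentation_cong A R `` {x @ y}),
     one = presentation_cong A R `` {[]}\<rparr>"

lemma equiv_presentation_cong: "equiv (lists A) (presentation_cong A R)"
proof (rule equivI)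
  have "u \<in> lists A \<and> v \<in> lists A" if "(u, v) \<in> presentation_cong A R" for u v
    using that by induction auto
  then show "presentation_cong A R \<subseteq> lists A \<times> lists A" by auto
  show "refl_on (lists A) (presentation_cong A R)"
    by (auto simp: refl_on_def intro: presentation_cong.refl)
  show "sym (presentation_cong A R)" by (auto intro: symI presentation_cong.sym)
  show "trans (presentation_cong A R)" by (auto intro: transI presentation_cong.trans)
qed

lemma presented_monoid_mult:
  assumes "u \<in> lists A" "v \<in> lists A"
  shows "presentation_cong A R `` {u} \<otimes>\<^bsub>presented_monoid A R\<^esub> presentation_cong A R `` {v} =
    presentation_cong A R `` {u @ v}"
proof -
  have "congruent2 (presentation_cong A R) (presentation_cong A R)
      (\<lambda>u v. presentation_cong A R `` {u @ v})"
    by (auto simp: congruent2_def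
        intro!: equiv_class_eq[OF equiv_presentation_cong] presentation_cong.append)
  from UN_equiv_class2[OF equiv_presentation_cong equiv_presentation_cong this assms]
  show ?thesis by (simp add: presented_monoid_def)
qed

lemma monoid_presented_monoid: "monoid (presented_monoid A R)"
proof (rule monoidI)
  have one: "\<one>\<^bsub>presented_monoid A R\<^esub> = presentation_cong A R `` {[]}"
    by (simp add: presented_monoid_def)
  have q: "\<exists>u\<in>lists A. x = presentation_cong A R `` {u}" if "x \<in> carrier (presented_monoid A R)" for x
    using that by (auto simp: presented_monoid_def quotient_def)
  have c: "presentation_cong A R `` {u} \<in> carrier (presented_monoid A R)" if "u \<in> lists A" for u
    using that by (auto simp: presented_monoid_def quotient_def)
  show "\<one>\<^bsub>presented_monoid A R\<^esub> \<in> carrier (presented_monoid A R)"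
    unfolding one by (rule c) simp
  fix x assume "x \<in> carrier (presented_monoid A R)"
  then obtain u where u: "u \<in> lists A" "x = presentation_cong A R `` {u}" using q by blast
  show "\<one>\<^bsub>presented_monoid A R\<^esub> \<otimes>\<^bsub>presented_monoid A R\<^esub> x = x"
    "x \<otimes>\<^bsub>presented_monoid A R\<^esub> \<one>\<^bsub>presented_monoid A R\<^esub> = x"
    using u by (simp_all add: one presented_monoid_mult)
  fix y assume "y \<in> carrier (presented_monoid A R)"
  then obtain v where v: "v \<in> lists A" "y = presentation_cong A R `` {v}" using q by blast
  have xy: "x \<otimes>\<^bsub>presented_monoid A R\<^esub> y = presentation_cong A R `` {u @ v}"
    using u v by (simp add: presented_monoid_mult)
  show "x \<otimes>\<^bsub>presented_monoid A R\<^esub> y \<in> carrier (presented_monoid A R)"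
    unfolding xy using u v by (intro c) simp
  fix z assume "z \<in> carrier (presented_monoid A R)"
  then obtain w where w: "w \<in> lists A" "z = presentation_cong A R `` {w}" using q by blast
  show "x \<otimes>\<^bsub>presented_monoid A R\<^esub> y \<otimes>\<^bsub>presented_monoid A R\<^esub> z =
      x \<otimes>\<^bsub>presented_monoid A R\<^esub> (y \<otimes>\<^bsub>presented_monoid A R\<^esub> z)"
    using u v w append_in_lists_conv by (simp add: presented_monoid_mult)
qed

definition plactic_rels :: "nat set \<Rightarrow> (nat list \<times> nat list) set" where
  "plactic_rels A =
    {([a,c,b], [c,a,b]) | a b c. a \<in> A \<and> b \<in> A \<and> c \<in> A \<and> a \<le> b \<and> b < c} \<union>
    {([b,a,c], [b,c,a]) | a b c. a \<in> A \<and> b \<in> A \<and> c \<in> A \<and> a < b \<and> b \<le> c}"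

definition stylic_rels :: "nat set \<Rightarrow> (nat list \<times> nat list) set" where
  "stylic_rels A = plactic_rels A \<union> {([a,a], [a]) | a. a \<in> A}"

definition hypoplactic_rels :: "nat set \<Rightarrow> (nat list \<times> nat list) set" where
  "hypoplactic_rels A = plactic_rels A \<union>
    {([c,a,d,b], [a,c,b,d]) | a b c d.
       a \<in> A \<and> b \<in> A \<and> c \<in> A \<and> d \<in> A \<and> a \<le> b \<and> b < c \<and> c \<le> d} \<union>
    {([b,d,a,c], [d,b,c,a]) | a b c d.
       a \<in> A \<and> b \<in> A \<and> c \<in> A \<and> d \<in> A \<and> a < b \<and> b \<le> c \<and> c < d}"

definition styl :: "nat \<Rightarrow> nat list set monoid" where
  "styl n = presented_monoid {1..n} (stylic_rels {1..n})"

definition hypo :: "nat list set monoid" where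
  "hypo = presented_monoid {1..} (hypoplactic_rels {1..})"

definition free_comm_monoid :: "'a set \<Rightarrow> 'a multiset monoid" where
  "free_comm_monoid A = \<lparr>carrier = {m. set_mset m \<subseteq> A}, monoid.mult = (+), one = {#}\<rparr>"


section \<open>Varieties of monoids\<close>

text \<open>
  A class of monoids is represented by its members with carrier in an arbitrary infinite
  type \<open>'u\<close>; results are meant to be stated for all such \<open>'u\<close>. As a direct product of members
  need not fit into \<open>'u\<close>, closure under direct products is expressed by
  requiring that every monoid over \<open>'u\<close> which is isomorphic to a submonoid of a direct product of
  members is itself a member (the whole product, when it fits into \<open>'u\<close>, being the special case
  of the improper submonoid). For actual varieties this follows from closure under direct products
  and submonoids. Index sets can be taken in \<open>'u\<close> without loss of generality, since a monoid over
  \<open>'u\<close> has at most \<open>|'u|\<close> pairs of elements to be separated by projections; see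
  \<open>monoid_variety_subproduct\<close> below for arbitrary index types.
\<close>

definition monoid_variety :: "'u::infinite monoid set \<Rightarrow> bool" where
  "monoid_variety \<V> \<longleftrightarrow>
    (\<forall>M\<in>\<V>. monoid M) \<and>
    (\<forall>M\<in>\<V>. \<forall>N :: 'u monoid. monoid N \<and> epi M N \<noteq> {} \<longrightarrow> N \<in> \<V>) \<and>
    (\<forall>M\<in>\<V>. \<forall>H. submonoid H M \<longrightarrow> M\<lparr>carrier := H\<rparr> \<in> \<V>) \<and>
    (\<forall>(I :: 'u set) (F :: 'u \<Rightarrow> 'u monoid) H (N :: 'u monoid).
       (\<forall>i\<in>I. F i \<in> \<V>) \<and> submonoid H (product_group I F) \<and>
       monoid N \<and> N \<cong> (product_group I F)\<lparr>carrier := H\<rparr> \<longrightarrow> N \<in> \<V>)"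

lemma monoid_variety_monoid: "\<lbrakk>monoid_variety \<V>; M \<in> \<V>\<rbrakk> \<Longrightarrow> monoid M"
  unfolding monoid_variety_def by (elim conjE bspec)

lemma monoid_variety_epi:
  "\<lbrakk>monoid_variety \<V>; M \<in> \<V>; monoid N; f \<in> epi M N\<rbrakk> \<Longrightarrow> N \<in> \<V>"
  for N :: "'u::infinite monoid"
  unfolding monoid_variety_def by (elim conjE) (drule (1) bspec, blast)

lemma monoid_variety_submonoid:
  "\<lbrakk>monoid_variety \<V>; M \<in> \<V>; submonoid H M\<rbrakk> \<Longrightarrow> M\<lparr>carrier := H\<rparr> \<in> \<V>"
  unfolding monoid_variety_def by (elim conjE) (drule (1) bspec, drule (1) bspec, simp)

lemma monoid_variety_subproduct:
  fixes I :: "'i set" and F :: "'i \<Rightarrow> 'u::infinite monoid" and N :: "'u monoid"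
  assumes V: "monoid_variety \<V>" and F: "\<And>i. i \<in> I \<Longrightarrow> F i \<in> \<V>"
    and H: "submonoid H (product_group I F)" and N: "monoid N"
    and iso: "N \<cong> (product_group I F)\<lparr>carrier := H\<rparr>"
  shows "N \<in> \<V>"
proof -
  from iso obtain f where fhom: "f \<in> hom N ((product_group I F)\<lparr>carrier := H\<rparr>)"
    and fbij: "bij_betw f (carrier N) H"
    by (auto simp: is_iso_def iso_def)
  have inj: "inj_on f (carrier N)" and im: "f ` carrier N = H"
    using fbij by (auto simp: bij_betw_def)
  have Hsub: "H \<subseteq> (\<Pi>\<^sub>E i\<in>I. carrier (F i))"
    using submonoid.subset[OF H] by simp
  have fin: "f x \<in> (\<Pi>\<^sub>E i\<in>I. carrier (F i))" if "x \<in> carrier N" for x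
    using that im Hsub by blast
  have fmult: "f (x \<otimes>\<^bsub>N\<^esub> y) = (\<lambda>i\<in>I. f x i \<otimes>\<^bsub>F i\<^esub> f y i)" if "x \<in> carrier N" "y \<in> carrier N" for x y
    using hom_mult[OF fhom that] by simp
  have Fmon: "monoid (F i)" if "i \<in> I" for i
    using monoid_variety_monoid[OF V F[OF that]] .
  define P where "P = {(x, y). x \<in> carrier N \<and> y \<in> carrier N \<and> x \<noteq> y}"
  have "\<exists>i\<in>I. f x i \<noteq> f y i" if "(x, y) \<in> P" for x y
  proof (rule ccontr)
    assume "\<not> ?thesis"
    then have "f x = f y"
      using that by (intro PiE_ext[OF fin fin]) (auto simp: P_def)
    then show False using that inj by (auto simp: P_def inj_on_def)
  qed
  then have "\<forall>p. \<exists>i. p \<in> P \<longrightarrow> i \<in> I \<and> f (fst p) i \<noteq> f (snd p) i"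
    by auto
  then obtain s where s: "\<And>p. p \<in> P \<Longrightarrow> s p \<in> I \<and> f (fst p) (s p) \<noteq> f (snd p) (s p)"
    by metis
  obtain e :: "'u \<times> 'u \<Rightarrow> 'u" where e: "bij e"
    using card_of_Times_same_infinite[OF infinite_UNIV[where 'a = 'u]]
    unfolding card_of_ordIso[symmetric] UNIV_Times_UNIV by blast
  define J where "J = e ` P"
  define G where "G = (\<lambda>j. F (s (inv_into UNIV e j)))"
  define g where "g = (\<lambda>x. \<lambda>j\<in>J. f x (s (inv_into UNIV e j)))"
  have sJ: "s (inv_into UNIV e j) \<in> I" if "j \<in> J" for j
    using that s e by (auto simp: J_def bij_is_inj)
  have gin: "g x \<in> (\<Pi>\<^sub>E j\<in>J. carrier (G j))" if "x \<in> carrier N" for x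
    using fin[OF that] sJ by (auto simp: g_def G_def PiE_iff)
  have gmult: "g (x \<otimes>\<^bsub>N\<^esub> y) = (\<lambda>j\<in>J. g x j \<otimes>\<^bsub>G j\<^esub> g y j)" if "x \<in> carrier N" "y \<in> carrier N" for x y
    using sJ by (auto simp: g_def G_def fmult[OF that] intro!: restrict_ext)
  obtain u where u: "u \<in> carrier N" "f u = (\<lambda>i\<in>I. \<one>\<^bsub>F i\<^esub>)"
    using submonoid.one_closed[OF H] im by (auto simp: image_iff)
  have gone: "g u = (\<lambda>j\<in>J. \<one>\<^bsub>G j\<^esub>)"
    using sJ by (auto simp: g_def G_def u(2) intro!: restrict_ext)
  have ginj: "inj_on g (carrier N)"
  proof (rule inj_onI, rule ccontr)
    fix x y assume x: "x \<in> carrier N" and y: "y \<in> carrier N" and eq: "g x = g y" and ne: "x \<noteq> y"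
    then have p: "(x, y) \<in> P" by (auto simp: P_def)
    then have "e (x, y) \<in> J" by (auto simp: J_def)
    then have "f x (s (x, y)) = f y (s (x, y))"
      using fun_cong[OF eq, of "e (x, y)"] e by (simp add: g_def bij_is_inj)
    then show False using s[OF p] by simp
  qed
  interpret N: monoid N by (rule N)
  have sub: "submonoid (g ` carrier N) (product_group J G)"
  proof
    show "g ` carrier N \<subseteq> carrier (product_group J G)" using gin by auto
    show "\<one>\<^bsub>product_group J G\<^esub> \<in> g ` carrier N" 
      unfolding one_product_group gone[symmetric] using u(1) by (rule imageI)
    fix a b assume "a \<in> g ` carrier N" "b \<in> g ` carrier N"
    then obtain x y where xy: "x \<in> carrier N" "y \<in> carrier N" "a = g x" "b = g y" by auto
    then have "a \<otimes>\<^bsub>product_group J G\<^esub> b = g (x \<otimes>\<^bsub>N\<^esub> y)"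
      using gmult by simp
    then show "a \<otimes>\<^bsub>product_group J G\<^esub> b \<in> g ` carrier N" using xy by auto
  qed
  have "g \<in> iso N ((product_group J G)\<lparr>carrier := g ` carrier N\<rparr>)"
    using ginj gmult by (auto simp: iso_def hom_def bij_betw_def)
  then have "N \<cong> (product_group J G)\<lparr>carrier := g ` carrier N\<rparr>"
    by (rule is_isoI)
  moreover have "\<forall>j\<in>J. G j \<in> \<V>" using sJ F by (auto simp: G_def)
  moreover have "(\<forall>j\<in>J. G j \<in> \<V>) \<and> submonoid (g ` carrier N) (product_group J G) \<and> monoid N \<and>
      N \<cong> (product_group J G)\<lparr>carrier := g ` carrier N\<rparr> \<longrightarrow> N \<in> \<V>"
    using V unfolding monoid_variety_def by (elim conjE) (drule spec[where x = J],
      drule spec[where x = G], drule spec[where x = "g ` carrier N"], drule spec[where x = N])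
  ultimately show ?thesis using sub N by (simp only: simp_thms)
qed

definition variety_generated :: "'u::infinite monoid set \<Rightarrow> 'u monoid set" where
  "variety_generated \<K> = \<Inter>{\<V>. monoid_variety \<V> \<and> \<K> \<subseteq> \<V>}"

text \<open>The isomorphic copies over \<open>'u\<close> of a monoid over some other type.\<close>

definition copies :: "'m monoid \<Rightarrow> 'u::infinite monoid set" where
  "copies M = {N. monoid N \<and> N \<cong> M}"

definition variety_of :: "'m monoid \<Rightarrow> 'u::infinite monoid set" where
  "variety_of M = variety_generated (copies M)"

definition variety_join :: "'u::infinite monoid set \<Rightarrow> 'u monoid set \<Rightarrow> 'u monoid set" where
  "variety_join \<U> \<W> = variety_generated (\<U> \<union> \<W>)"

definition commutative_monoids :: "'u::infinite monoid set" where
  "commutative_monoids = {M. comm_monoid M}"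

lemma monoid_product_group:
  assumes "\<And>i. i \<in> I \<Longrightarrow> monoid (F i)"
  shows "monoid (product_group I F)"
proof (rule monoidI)
  note m = monoid.m_closed[OF assms] monoid.one_closed[OF assms] monoid.m_assoc[OF assms]
    monoid.l_one[OF assms] monoid.r_one[OF assms]
  show "\<one>\<^bsub>product_group I F\<^esub> \<in> carrier (product_group I F)" by (auto simp: m)
  fix x assume x: "x \<in> carrier (product_group I F)"
  show "\<one>\<^bsub>product_group I F\<^esub> \<otimes>\<^bsub>product_group I F\<^esub> x = x"
    "x \<otimes>\<^bsub>product_group I F\<^esub> \<one>\<^bsub>product_group I F\<^esub> = x"
    using x by (auto simp: fun_eq_iff m PiE_iff extensional_def)
  fix y assume y: "y \<in> carrier (product_group I F)"
  show "x \<otimes>\<^bsub>product_group I F\<^esub> y \<in> carrier (product_group I F)"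
    using x y by (auto simp: m PiE_iff)
  fix z assume z: "z \<in> carrier (product_group I F)"
  show "x \<otimes>\<^bsub>product_group I F\<^esub> y \<otimes>\<^bsub>product_group I F\<^esub> z =
      x \<otimes>\<^bsub>product_group I F\<^esub> (y \<otimes>\<^bsub>product_group I F\<^esub> z)"
    using x y z by (auto simp: fun_eq_iff m PiE_iff)
qed

lemma monoid_variety_commutative_monoids:
  "monoid_variety (commutative_monoids :: 'u::infinite monoid set)"
  unfolding monoid_variety_def commutative_monoids_def
proof (intro conjI ballI allI impI; (elim conjE)?)
  fix M :: "'u monoid" assume "M \<in> Collect comm_monoid"
  then interpret M: comm_monoid M by simp
  show "monoid M" by unfold_locales
next
  fix M N :: "'u monoid" assume "M \<in> Collect comm_monoid" and N: "monoid N" and "epi M N \<noteq> {}"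
  then interpret M: comm_monoid M by simp
  obtain f where f: "f \<in> hom M N" "f ` carrier M = carrier N"
    using \<open>epi M N \<noteq> {}\<close> by (auto simp: epi_def)
  show "N \<in> Collect comm_monoid" unfolding mem_Collect_eq
  proof (rule monoid.monoid_comm_monoidI[OF N])
    fix x y assume "x \<in> carrier N" "y \<in> carrier N"
    then obtain a b where "a \<in> carrier M" "b \<in> carrier M" "x = f a" "y = f b"
      using f(2) by blast
    then show "x \<otimes>\<^bsub>N\<^esub> y = y \<otimes>\<^bsub>N\<^esub> x"
      using hom_mult[OF f(1)] M.m_comm by metis
  qed
next
  fix M :: "'u monoid" and H assume "M \<in> Collect comm_monoid" and H: "submonoid H M"
  then interpret M: comm_monoid M by simp
  show "M\<lparr>carrier := H\<rparr> \<in> Collect comm_monoid" unfolding mem_Collect_eq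
    using submonoid.subset[OF H] M.m_comm
    by (intro monoid.monoid_comm_monoidI submonoid.submonoid_is_monoid[OF H])
       (auto intro: M.monoid_axioms)
next
  fix I :: "'u set" and F :: "'u \<Rightarrow> 'u monoid" and H and N :: "'u monoid"
  assume F: "\<forall>i\<in>I. F i \<in> Collect comm_monoid" and H: "submonoid H (product_group I F)"
    and N: "monoid N" and iso: "N \<cong> (product_group I F)\<lparr>carrier := H\<rparr>"
  from iso obtain f where f: "f \<in> hom N ((product_group I F)\<lparr>carrier := H\<rparr>)"
    and bij: "bij_betw f (carrier N) H"
    by (auto simp: is_iso_def iso_def)
  show "N \<in> Collect comm_monoid" unfolding mem_Collect_eq
  proof (rule monoid.monoid_comm_monoidI[OF N])
    fix x y assume x: "x \<in> carrier N" and y: "y \<in> carrier N"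
    have "f x \<in> (\<Pi>\<^sub>E i\<in>I. carrier (F i))" "f y \<in> (\<Pi>\<^sub>E i\<in>I. carrier (F i))"
      using bij x y submonoid.subset[OF H] by (auto simp: bij_betw_def)
    then have "f (x \<otimes>\<^bsub>N\<^esub> y) = f (y \<otimes>\<^bsub>N\<^esub> x)"
      using hom_mult[OF f x y] hom_mult[OF f y x] F
      by (auto simp: PiE_iff comm_monoid.m_comm intro!: restrict_ext)
    then show "x \<otimes>\<^bsub>N\<^esub> y = y \<otimes>\<^bsub>N\<^esub> x"
      using bij x y monoid.m_closed[OF N] by (auto simp: bij_betw_def inj_on_def)
  qed
qed

lemma comm_monoid_free_comm_monoid: "comm_monoid (free_comm_monoid A)"
  by (rule comm_monoidI) (auto simp: free_comm_monoid_def)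

lemma monoid_variety_all: "monoid_variety (Collect monoid :: 'u::infinite monoid set)"
  unfolding monoid_variety_def
proof (intro conjI ballI allI impI; (elim conjE)?)
  fix M :: "'u monoid" and H assume "M \<in> Collect monoid" "submonoid H M"
  then show "M\<lparr>carrier := H\<rparr> \<in> Collect monoid"
    by (simp add: submonoid.submonoid_is_monoid)
qed simp_all

lemma monoid_variety_generated:
  assumes "\<And>M. M \<in> \<K> \<Longrightarrow> monoid M"
  shows "monoid_variety (variety_generated \<K>)"
proof -
  let ?V = "variety_generated \<K>"
  have least: "x \<in> \<V>" if "x \<in> ?V" "monoid_variety \<V>" "\<K> \<subseteq> \<V>" for x \<V>
    using that by (auto simp: variety_generated_def)
  have mem: "x \<in> ?V" if "\<And>\<V>. monoid_variety \<V> \<Longrightarrow> \<K> \<subseteq> \<V> \<Longrightarrow> x \<in> \<V>" for x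
    using that by (auto simp: variety_generated_def)
  show ?thesis
    unfolding monoid_variety_def
  proof (intro conjI ballI allI impI; (elim conjE)?)
    fix M assume "M \<in> ?V"
    then show "monoid M"
      using least[OF _ monoid_variety_all] assms by auto
  next
    fix M N :: "'a monoid" assume M: "M \<in> ?V" and N: "monoid N" and "epi M N \<noteq> {}"
    then obtain f where f: "f \<in> epi M N" by blast
    show "N \<in> ?V"
      by (rule mem, rule monoid_variety_epi[OF _ least[OF M] N f])
  next
    fix M :: "'a monoid" and H assume M: "M \<in> ?V" and H: "submonoid H M"
    show "M\<lparr>carrier := H\<rparr> \<in> ?V"
      by (rule mem, rule monoid_variety_submonoid[OF _ least[OF M] H])
  next
    fix I :: "'a set" and F :: "'a \<Rightarrow> 'a monoid" and H and N :: "'a monoid"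
    assume F: "\<forall>i\<in>I. F i \<in> ?V" and H: "submonoid H (product_group I F)"
      and N: "monoid N" and iso: "N \<cong> (product_group I F)\<lparr>carrier := H\<rparr>"
    show "N \<in> ?V"
      by (rule mem, rule monoid_variety_subproduct[OF _ least[OF bspec[OF F]] H N iso])
  qed
qed

lemma variety_generated_least:
  "\<lbrakk>monoid_variety \<V>; \<K> \<subseteq> \<V>\<rbrakk> \<Longrightarrow> variety_generated \<K> \<subseteq> \<V>"
  by (auto simp: variety_generated_def)

lemma copies_nonempty:
  assumes M: "monoid M" and "countable (carrier M)"
  shows "(copies M :: 'u::infinite monoid set) \<noteq> {}"
proof -
  interpret M: monoid M by (rule M)
  obtain t :: "nat \<Rightarrow> 'u" where t: "inj t"
    using infinite_countable_subset[OF infinite_UNIV] by blast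
  define f where "f = t \<circ> to_nat_on (carrier M)"
  have f: "inj_on f (carrier M)"
    unfolding f_def by (rule comp_inj_on) (use assms t in \<open>auto intro: inj_on_subset\<close>)
  define g where "g = the_inv_into (carrier M) f"
  have g: "g (f x) = x" if "x \<in> carrier M" for x
    using that f by (simp add: g_def the_inv_into_f_f)
  define N where "N = \<lparr>carrier = f ` carrier M,
    monoid.mult = (\<lambda>x y. f (g x \<otimes>\<^bsub>M\<^esub> g y)), one = f \<one>\<^bsub>M\<^esub>\<rparr>"
  have "monoid N"
    by (rule monoidI) (auto simp: N_def g M.m_assoc)
  moreover have "g \<in> iso N M"
    using f g by (auto simp: iso_def hom_def N_def bij_betw_def inj_on_def image_image)
  ultimately show ?thesis by (auto simp: copies_def is_iso_def)
qed

end

theory Submission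
  imports Defs "HOL-Algebra.FiniteProduct" "HOL-Library.Dual_Ordered_Lattice"
begin

text \<open>
  Two words are hypoplactic congruent iff they have the same content and, for all letters
  \<open>i < j\<close>, they agree on whether some letter strictly between \<open>i\<close> and \<open>j\<close> occurs or some \<open>j\<close>
  precedes some \<open>i\<close>. The content is a homomorphism to the free commutative monoid, and each of the
  other conditions is read off a homomorphism to \<open>styl\<^sub>2\<close>; hence \<open>hypo\<close> is a subdirect product of
  copies of these two monoids, which conversely are quotients of \<open>hypo\<close>. Finally, a commutative
  monoid is a quotient of a free commutative monoid, and the latter embeds into a power of
  \<open>(\<nat>, +)\<close>.
\<close>

section \<open>A solution of the word problem of the hypoplactic monoid\<close>

text \<open>The clause on letters strictly between is forced: for \<open>a < b < c\<close> the
  relation \<open>acb = cab\<close> moves \<open>c\<close> across \<open>a\<close>, so the order of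
  \<open>i\<close> and \<open>j\<close> can be invariant only while no occurring letter separates
  them. The obstacle is completeness. Neighbours \<open>c\<close>, \<open>a\<close> with
  \<open>a < c\<close> may be exchanged whenever there is a witness: a letter of
  \<open>(a, c]\<close> to their left or of \<open>[a, c)\<close> to their right. The cubic
  relations need the witness next to the pair, and the quartic ones bridge one more letter. A
  witness at arbitrary distance is reached by induction on the length of words, since completeness
  for shorter words rearranges proper factors at will. This is the hypothesis \<open>IH\<close> of
  the exchange lemmas.\<close>

primrec crossed :: "'a::linorder \<Rightarrow> 'a \<Rightarrow> 'a list \<Rightarrow> bool" where
  "crossed i j [] \<longleftrightarrow> False"
| "crossed i j (x # u) \<longleftrightarrow> i < x \<and> x < j \<or> x = j \<and> i \<in> set u \<or> crossed i j u"

definition hypo_equiv :: "'a::linorder list \<Rightarrow> 'a list \<Rightarrow> bool" where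
  "hypo_equiv u v \<longleftrightarrow> mset u = mset v \<and> (\<forall>i j. i < j \<longrightarrow> crossed i j u = crossed i j v)"

text \<open>The mixed term depends only on supports, so supports together with the values of
  \<open>crossed\<close> are compatible with concatenation. This makes \<open>hypo_equiv\<close> a
  congruence.\<close>

lemma crossed_append [simp]:
  "crossed i j (u @ v) \<longleftrightarrow> crossed i j u \<or> crossed i j v \<or> j \<in> set u \<and> i \<in> set v"
  by (induction u) auto

text \<open>Letters outside the closed interval from \<open>i\<close> to \<open>j\<close> are never
  consulted; this later separates the low from the high letters of a word.\<close>

lemma crossed_filter:
  "(\<And>x. x \<in> set u \<Longrightarrow> i \<le> x \<Longrightarrow> x \<le> j \<Longrightarrow> P x) \<Longrightarrow> i < j \<Longrightarrow>
    crossed i j (filter P u) = crossed i j u"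
  by (induction u) (auto simp: order.strict_iff_order)

lemma crossed_between: "x \<in> set u \<Longrightarrow> i < x \<Longrightarrow> x < j \<Longrightarrow> crossed i j u"
  by (induction u) auto

lemma crossed_imp:
  "crossed i j u \<Longrightarrow> i < j \<Longrightarrow> (\<exists>x\<in>set u. i < x \<and> x < j) \<or> i \<in> set u \<and> j \<in> set u"
  by (induction u) auto

lemma hypo_equiv_refl [simp]: "hypo_equiv u u"
  by (simp add: hypo_equiv_def)

lemma hypo_equiv_sym: "hypo_equiv u v \<Longrightarrow> hypo_equiv v u"
  by (auto simp: hypo_equiv_def)

lemma hypo_equiv_trans: "hypo_equiv u v \<Longrightarrow> hypo_equiv v w \<Longrightarrow> hypo_equiv u w"
  by (auto simp: hypo_equiv_def)

lemma hypo_equiv_append: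
  assumes "hypo_equiv u v" "hypo_equiv u' v'"
  shows "hypo_equiv (u @ u') (v @ v')"
proof -
  have "set u = set v" "set u' = set v'"
    using assms by (auto simp: hypo_equiv_def dest: mset_eq_setD)
  then show ?thesis using assms by (auto simp: hypo_equiv_def)
qed

text \<open>The congruence and the linear order are parameters so that the same arguments can be
  reused for the reversed order.\<close>

locale hypoplactic =
  fixes R :: "'a::linorder list \<Rightarrow> 'a list \<Rightarrow> bool" (infix "\<sim>" 50)
  assumes R_refl: "u \<sim> u"
    and R_sym: "u \<sim> v \<Longrightarrow> v \<sim> u"
    and R_trans [trans]: "u \<sim> v \<Longrightarrow> v \<sim> w \<Longrightarrow> u \<sim> w"
    and R_append: "u \<sim> v \<Longrightarrow> u' \<sim> v' \<Longrightarrow> u @ u' \<sim> v @ v'"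
    and plactic1: "a \<le> b \<Longrightarrow> b < c \<Longrightarrow> [a,c,b] \<sim> [c,a,b]"
    and plactic2: "a < b \<Longrightarrow> b \<le> c \<Longrightarrow> [b,a,c] \<sim> [b,c,a]"
    and hypo1: "a \<le> b \<Longrightarrow> b < c \<Longrightarrow> c \<le> d \<Longrightarrow> [c,a,d,b] \<sim> [a,c,b,d]"
    and hypo2: "a < b \<Longrightarrow> b \<le> c \<Longrightarrow> c < d \<Longrightarrow> [b,d,a,c] \<sim> [d,b,c,a]"
begin

section \<open>Exchanging neighbours with a witness to their right\<close>

lemma R_context: "u \<sim> v \<Longrightarrow> p @ u @ q \<sim> p @ v @ q"
  by (intro R_append R_refl)

lemma R_prefix: "u \<sim> v \<Longrightarrow> u @ q \<sim> v @ q"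
  by (intro R_append R_refl)

lemma R_suffix: "u \<sim> v \<Longrightarrow> p @ u \<sim> p @ v"
  by (intro R_append R_refl)

text \<open>A cubic relation settles empty \<open>r\<close>; a quartic and a cubic one settle a
  single letter. For longer \<open>r\<close> an end letter leaves the factor, the exchange takes
  place in a shorter word, and the letter returns. If the first letter \<open>d\<close> is at most
  the last letter \<open>e\<close>, then \<open>d\<close> lies in \<open>(b, e]\<close> and lets
  \<open>e\<close> pass behind \<open>b\<close>; otherwise \<open>e\<close> lies in
  \<open>[c, d)\<close> and lets \<open>d\<close> pass in front of \<open>c\<close> and
  \<open>a\<close>.\<close>

lemma swap_before_high:
  assumes IH: "\<And>u v. length u < length r + 3 \<Longrightarrow> hypo_equiv u v \<Longrightarrow> u \<sim> v"
    and ab: "a \<le> b" and bc: "b < c" and high: "\<And>x. x \<in> set r \<Longrightarrow> c \<le> x"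
  shows "[c,a] @ r @ [b] \<sim> [a,c] @ r @ [b]"
proof (cases r)
  case Nil
  then show ?thesis using R_sym[OF plactic1[OF ab bc]] by simp
next
  case (Cons d r')
  have cd: "c \<le> d" using high Cons by simp
  show ?thesis
  proof (cases r' rule: rev_cases)
    case Nil
    have "[c,a,d,b] \<sim> [a,c,b,d]" by (rule hypo1[OF ab bc cd])
    also have "[a,c,b,d] \<sim> [a,c,d,b]"
      using R_suffix[OF plactic2[OF bc cd], of "[a]"] by simp
    finally show ?thesis using Cons Nil by simp
  next
    case (snoc s e)
    have ce: "c \<le> e" using high Cons snoc by simp
    have len: "length r = length s + 2" using Cons snoc by simp
    show ?thesis
    proof (cases "d \<le> e")
      case True
      have 1: "[d] @ s @ [e,b] \<sim> [d] @ s @ [b,e]"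
        by (rule IH) (use len ab bc cd ce True in \<open>auto simp: hypo_equiv_def\<close>)
      have 2: "[c,a,d] @ s @ [b] \<sim> [a,c,d] @ s @ [b]"
        by (rule IH) (use len ab bc cd ce True in \<open>auto simp: hypo_equiv_def\<close>)
      have "[c,a] @ [d] @ s @ [e,b] \<sim> [c,a] @ [d] @ s @ [b,e]" by (rule R_suffix[OF 1])
      also have "\<dots> \<sim> [a,c] @ [d] @ s @ [b,e]"
        using R_prefix[OF 2, of "[e]"] by simp
      also have "\<dots> \<sim> [a,c] @ [d] @ s @ [e,b]" by (rule R_suffix[OF R_sym[OF 1]])
      finally show ?thesis using Cons snoc by simp
    next
      case False
      have 1: "[c,a,d] @ s @ [e] \<sim> [d,c,a] @ s @ [e]"
        by (rule IH) (use len ab bc cd ce False in \<open>auto simp: hypo_equiv_def\<close>)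
      have 2: "[c,a] @ s @ [e,b] \<sim> [a,c] @ s @ [e,b]"
        by (rule IH) (use len ab bc cd ce False in \<open>auto simp: hypo_equiv_def\<close>)
      have 3: "[d,a,c] @ s @ [e] \<sim> [a,c,d] @ s @ [e]"
        by (rule IH) (use len ab bc cd ce False in \<open>auto simp: hypo_equiv_def\<close>)
      have "[c,a,d] @ s @ [e,b] \<sim> [d,c,a] @ s @ [e,b]"
        using R_prefix[OF 1, of "[b]"] by simp
      also have "\<dots> \<sim> [d,a,c] @ s @ [e,b]"
        using R_suffix[OF 2, of "[d]"] by simp
      also have "\<dots> \<sim> [a,c,d] @ s @ [e,b]"
        using R_prefix[OF 3, of "[b]"] by simp
      finally show ?thesis using Cons snoc by simp
    qed
  qed
qed

text \<open>The scheme of \<open>swap_before_high\<close>, with the two orders of \<open>d\<close>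
  and \<open>e\<close> trading places: if \<open>e < d\<close>, then \<open>d\<close> lies in
  \<open>(e, b]\<close> and lets \<open>e\<close> pass behind \<open>b\<close>; otherwise
  \<open>e\<close> lies in \<open>[d, a)\<close> and lets \<open>d\<close> pass in front of
  \<open>c\<close> and \<open>a\<close>.\<close>

lemma swap_before_low:
  assumes IH: "\<And>u v. length u < length r + 3 \<Longrightarrow> hypo_equiv u v \<Longrightarrow> u \<sim> v"
    and ab: "a \<le> b" and bc: "b < c" and low: "\<And>x. x \<in> set r \<Longrightarrow> x < a"
  shows "[c,a] @ r @ [b] \<sim> [a,c] @ r @ [b]"
proof (cases r)
  case Nil
  then show ?thesis using R_sym[OF plactic1[OF ab bc]] by simp
next
  case (Cons d r')
  have da: "d < a" using low Cons by simp
  show ?thesis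
  proof (cases r' rule: rev_cases)
    case Nil
    have "[c,a,d,b] \<sim> [c,a,b,d]"
      using R_suffix[OF plactic2[OF da ab], of "[c]"] by simp
    also have "\<dots> \<sim> [a,c,d,b]"
      by (rule R_sym, rule hypo2[OF da ab bc])
    finally show ?thesis using Cons Nil by simp
  next
    case (snoc s e)
    have ea: "e < a" using low Cons snoc by simp
    have len: "length r = length s + 2" using Cons snoc by simp
    show ?thesis
    proof (cases "d \<le> e")
      case False
      have 1: "[d] @ s @ [e,b] \<sim> [d] @ s @ [b,e]"
        by (rule IH) (use len ab bc da ea False in \<open>auto simp: hypo_equiv_def\<close>)
      have 2: "[c,a,d] @ s @ [b] \<sim> [a,c,d] @ s @ [b]"
        by (rule IH) (use len ab bc da ea False in \<open>auto simp: hypo_equiv_def\<close>)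
      have "[c,a] @ [d] @ s @ [e,b] \<sim> [c,a] @ [d] @ s @ [b,e]" by (rule R_suffix[OF 1])
      also have "\<dots> \<sim> [a,c] @ [d] @ s @ [b,e]"
        using R_prefix[OF 2, of "[e]"] by simp
      also have "\<dots> \<sim> [a,c] @ [d] @ s @ [e,b]" by (rule R_suffix[OF R_sym[OF 1]])
      finally show ?thesis using Cons snoc by simp
    next
      case True
      have 1: "[c,a,d] @ s @ [e] \<sim> [d,c,a] @ s @ [e]"
        by (rule IH) (use len ab bc da ea True in \<open>auto simp: hypo_equiv_def\<close>)
      have 2: "[c,a] @ s @ [e,b] \<sim> [a,c] @ s @ [e,b]"
        by (rule IH) (use len ab bc da ea True in \<open>auto simp: hypo_equiv_def\<close>)
      have 3: "[d,a,c] @ s @ [e] \<sim> [a,c,d] @ s @ [e]"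
        by (rule IH) (use len ab bc da ea True in \<open>auto simp: hypo_equiv_def\<close>)
      have "[c,a,d] @ s @ [e,b] \<sim> [d,c,a] @ s @ [e,b]"
        using R_prefix[OF 1, of "[b]"] by simp
      also have "\<dots> \<sim> [d,a,c] @ s @ [e,b]"
        using R_suffix[OF 2, of "[d]"] by simp
      also have "\<dots> \<sim> [a,c,d] @ s @ [e,b]"
        using R_prefix[OF 3, of "[b]"] by simp
      finally show ?thesis using Cons snoc by simp
    qed
  qed
qed

text \<open>
  The three cases below: if \<open>r\<close> has a letter in \<open>[a, c)\<close>, a shorter word suffices; if all letters
  of \<open>r\<close> lie on the same side of \<open>[a, c)\<close>, the previous lemmas apply; otherwise \<open>r\<close> is split into its
  low and high letters, so that each of these parts can leave the factor in which \<open>c\<close> and \<open>a\<close> are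
  exchanged.
\<close>

lemma swap_before:
  assumes IH: "\<And>u v. length u < length r + 3 \<Longrightarrow> hypo_equiv u v \<Longrightarrow> u \<sim> v"
    and ab: "a \<le> b" and bc: "b < c"
  shows "[c,a] @ r @ [b] \<sim> [a,c] @ r @ [b]"
proof (cases "\<exists>x\<in>set r. a \<le> x \<and> x < c")
  case True
  then obtain s x t where r: "r = s @ x # t" and x: "a \<le> x" "x < c"
    by (auto dest: split_list)
  have "[c,a] @ s @ [x] \<sim> [a,c] @ s @ [x]"
    by (rule IH) (use r x in \<open>auto simp: hypo_equiv_def\<close>)
  from R_prefix[OF this, of "t @ [b]"] show ?thesis using r by simp
next
  case False
  \<comment> \<open>As no letter of \<open>r\<close> lies in \<open>[a, c)\<close>, cutting at
    \<open>b\<close> is cutting at this gap: the low part stays below \<open>a\<close>, the high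
    part is at least \<open>c\<close>.\<close>
  define l where "l = filter (\<lambda>x. x < b) r"
  define h where "h = filter (\<lambda>x. \<not> x < b) r"
  have l: "x < a" if "x \<in> set l" for x
    using False that bc by (force simp: l_def)
  have h: "c \<le> x" if "x \<in> set h" for x
    using False that ab by (force simp: h_def)
  show ?thesis
  proof (cases "l = [] \<or> h = []")
    case True
    then have "(\<forall>x\<in>set r. x < a) \<or> (\<forall>x\<in>set r. c \<le> x)"
      using l h by (fastforce simp: l_def h_def filter_empty_conv)
    then show ?thesis
      using swap_before_low[OF IH ab bc] swap_before_high[OF IH ab bc] by blast
  next
    case ne: False
    have set_r: "set r = set l \<union> set h" by (auto simp: l_def h_def)
    have mset_r: "mset r = mset l + mset h" by (simp add: l_def h_def)
    have len_r: "length r = length l + length h"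
      using arg_cong[OF mset_r, of size] by simp
    have low: "crossed i j r = crossed i j l" if "i < j" "j \<le> b" for i j
      unfolding l_def
      by (rule crossed_filter[symmetric]) (use that ab bc l h set_r in fastforce)+
    have high: "crossed i j r = crossed i j h" if "i < j" "b \<le> i" for i j
      unfolding h_def
      by (rule crossed_filter[symmetric]) (use that ab bc l h set_r in fastforce)+
    have no_l: "\<not> crossed i j l" if "i < j" "b \<le> i" for i j
      using crossed_imp[of i j l] that l ab by fastforce
    have no_h: "\<not> crossed i j h" if "i < j" "j \<le> b" for i j
      using crossed_imp[of i j h] that h bc by fastforce
    \<comment> \<open>The words compared below all contain \<open>b\<close>, so every pair with
      \<open>i < b < j\<close> is crossed on both sides. Any other pair sees only one half of
      \<open>r\<close>.\<close>
    have r: "crossed i j r = (if j \<le> b then crossed i j l else crossed i j h)"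
      if "i < j" "\<not> (i < b \<and> b < j)" for i j
      using low[of i j] high[of i j] that by auto
    have bl: "b \<notin> set l" "b \<notin> set h" "a \<notin> set l" "a \<notin> set h" "c \<notin> set l"
      using l h ab bc by force+
    have 1: "[a] @ r @ [b] \<sim> [a] @ h @ [b] @ l"
    proof (rule IH)
      show "hypo_equiv ([a] @ r @ [b]) ([a] @ h @ [b] @ l)"
        unfolding hypo_equiv_def
      proof (intro conjI allI impI)
        fix i j :: 'a assume "i < j"
        show "crossed i j ([a] @ r @ [b]) = crossed i j ([a] @ h @ [b] @ l)"
        proof (cases "i < b \<and> b < j")
          case False
          then consider "j \<le> b" | "b \<le> i" by fastforce
          then show ?thesis
            by cases (use r[OF \<open>i < j\<close> False] no_l[of i j] no_h[of i j]
                l[of i] l[of j] h[of i] h[of j] bl ab bc \<open>i < j\<close> in \<open>auto simp: set_r\<close>)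
        qed simp
      qed (simp add: mset_r)
    qed simp
    have 2: "[c,a] @ h @ [b] \<sim> [a,c] @ h @ [b]"
      by (rule IH) (use ne ab bc len_r in \<open>auto simp: hypo_equiv_def\<close>)
    have 3: "[c] @ h @ [b] @ l \<sim> [c,b] @ l @ h"
    proof (rule IH)
      show "hypo_equiv ([c] @ h @ [b] @ l) ([c,b] @ l @ h)"
        unfolding hypo_equiv_def
      proof (intro conjI allI impI)
        fix i j :: 'a assume "i < j"
        show "crossed i j ([c] @ h @ [b] @ l) = crossed i j ([c,b] @ l @ h)"
        proof (cases "i < b \<and> b < j")
          case False
          then show ?thesis
            using no_l[of i j] no_h[of i j] l[of i] l[of j] h[of i] h[of j] bl ab bc \<open>i < j\<close>
            by auto
        qed simp
      qed simp
    qed (simp add: len_r)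
    have 4: "[a,c,b] @ l \<sim> [a,c] @ l @ [b]"
    proof (rule IH)
      show "hypo_equiv ([a,c,b] @ l) ([a,c] @ l @ [b])"
        unfolding hypo_equiv_def
      proof (intro conjI allI impI)
        fix i j :: 'a assume "i < j"
        show "crossed i j ([a,c,b] @ l) = crossed i j ([a,c] @ l @ [b])"
          using l[of i] l[of j] bl ab bc \<open>i < j\<close> by auto
      qed simp
    qed (use ne len_r in simp)
    have 5: "[c] @ l @ [b] @ h \<sim> [c] @ r @ [b]"
    proof (rule IH)
      show "hypo_equiv ([c] @ l @ [b] @ h) ([c] @ r @ [b])"
        unfolding hypo_equiv_def
      proof (intro conjI allI impI)
        fix i j :: 'a assume "i < j"
        show "crossed i j ([c] @ l @ [b] @ h) = crossed i j ([c] @ r @ [b])"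
        proof (cases "i < b \<and> b < j")
          case False
          then consider "j \<le> b" | "b \<le> i" by fastforce
          then show ?thesis
            by cases (use r[OF \<open>i < j\<close> False] no_l[of i j] no_h[of i j]
                l[of i] l[of j] h[of i] h[of j] bl ab bc \<open>i < j\<close> in \<open>auto simp: set_r\<close>)
        qed simp
      qed (simp add: mset_r)
    qed (simp add: len_r)
    \<comment> \<open>After 2 the letter \<open>c\<close> stands behind \<open>a\<close>, so 1
      cannot simply be undone. Facts 3, 4 and 5 return to \<open>r\<close> by rearrangements that
      leave out \<open>a\<close>, \<open>h\<close> and \<open>a\<close> in turn, hence concern
      shorter words.\<close>
    have "[c,a] @ r @ [b] \<sim> [c,a] @ h @ [b] @ l"
      using R_suffix[OF 1, of "[c]"] by simp
    also have "\<dots> \<sim> [a,c] @ h @ [b] @ l"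
      using R_prefix[OF 2, of l] by simp
    also have "\<dots> \<sim> [a,c,b] @ l @ h"
      using R_suffix[OF 3, of "[a]"] by simp
    also have "\<dots> \<sim> [a,c] @ l @ [b] @ h"
      using R_prefix[OF 4, of h] by simp
    also have "\<dots> \<sim> [a,c] @ r @ [b]"
      using R_suffix[OF 5, of "[a]"] by simp
    finally show ?thesis .
  qed
qed

end

section \<open>Reversal of words and order: the witness on the left\<close>

instance dual :: (linorder) linorder
  by standard (auto simp: less_eq_dual_def linear)

lemma hypo_equiv_dual:
  fixes u v :: "'a::linorder dual list"
  assumes "hypo_equiv u v"
  shows "hypo_equiv (rev (map undual u)) (rev (map undual v))"
proof -
  have mem: "x \<in> undual ` A \<longleftrightarrow> dual x \<in> A" for x :: 'a and A
    by (metis dual_undual image_iff undual_dual)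
  have crossed: "crossed i j (rev (map undual w)) = crossed (dual j) (dual i) w" if "i < j" for i j and w :: "'a dual list"
    using that by (induction w) (auto simp: mem less_dual_def dual_eq_iff)
  have "mset (map undual u) = mset (map undual v)"
    using assms by (simp add: hypo_equiv_def)
  then show ?thesis
    using assms by (auto simp: hypo_equiv_def crossed)
qed

context hypoplactic
begin

text \<open>Reversing words and order interchanges the two cubic families and maps each quartic
  family to itself.\<close>

lemma dual_hypoplactic: "hypoplactic (\<lambda>u v. rev (map undual u) \<sim> rev (map undual v))"
  by unfold_locales
    (auto intro: R_refl R_sym R_trans R_append plactic1 plactic2 hypo1 hypo2 simp: less_eq_dual_def less_dual_def)

lemma swap_after:
  assumes IH: "\<And>u v. length u < length r + 3 \<Longrightarrow> hypo_equiv u v \<Longrightarrow> u \<sim> v"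
    and ab: "a < b" and bc: "b \<le> c"
  shows "[b] @ r @ [c,a] \<sim> [b] @ r @ [a,c]"
proof -
  interpret dual: hypoplactic "\<lambda>u v. rev (map undual u) \<sim> rev (map undual v)"
    by (rule dual_hypoplactic)
  have "rev (map undual ([dual a, dual c] @ rev (map dual r) @ [dual b])) \<sim>
      rev (map undual ([dual c, dual a] @ rev (map dual r) @ [dual b]))"
    by (rule dual.swap_before) (use ab bc in \<open>auto intro: IH hypo_equiv_dual\<close>)
  then show ?thesis by (simp add: rev_map[symmetric] comp_def)
qed

lemma swap:
  assumes IH: "\<And>u v. length u < length p + length q + 2 \<Longrightarrow> hypo_equiv u v \<Longrightarrow> u \<sim> v"
    and ac: "a < c"
    and b: "(\<exists>b\<in>set p. a < b \<and> b \<le> c) \<or> (\<exists>b\<in>set q. a \<le> b \<and> b < c)"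
  shows "p @ [c,a] @ q \<sim> p @ [a,c] @ q"
  using b
proof
  assume "\<exists>b\<in>set p. a < b \<and> b \<le> c"
  then obtain s b r where p: "p = s @ b # r" and "a < b" "b \<le> c"
    by (auto dest: split_list)
  then have "[b] @ r @ [c,a] \<sim> [b] @ r @ [a,c]"
    by (intro swap_after) (auto intro: IH)
  from R_context[OF this, of s q] show ?thesis using p by simp
next
  assume "\<exists>b\<in>set q. a \<le> b \<and> b < c"
  then obtain r b s where q: "q = r @ b # s" and "a \<le> b" "b < c"
    by (auto dest: split_list)
  then have "[c,a] @ r @ [b] \<sim> [a,c] @ r @ [b]"
    by (intro swap_before[of r a b c]) (auto intro: IH)
  from R_context[OF this, of p s] show ?thesis using q by simp
qed

text \<open>Only the pair \<open>(a, c)\<close> can notice the exchange, and the witness makes this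
  pair crossed on both sides.\<close>

lemma sound_swap:
  "a < c \<Longrightarrow> (\<exists>b\<in>set p. a < b \<and> b \<le> c) \<or> (\<exists>b\<in>set q. a \<le> b \<and> b < c) \<Longrightarrow>
    hypo_equiv (p @ [c,a] @ q) (p @ [a,c] @ q)"
  using crossed_between[of _ p a c] crossed_between[of _ q a c]
  by (fastforce simp: hypo_equiv_def order.order_iff_strict)

text \<open>
  The hypoplactic monoid is not cancellative, so words are compared below a common prefix \<open>w\<close>
  that is kept throughout.
\<close>

lemma move_left:
  assumes IH: "\<And>u v. length u < length (w @ p @ x # q) \<Longrightarrow> hypo_equiv u v \<Longrightarrow> u \<sim> v"
    and eq: "hypo_equiv (w @ x # u) (w @ p @ x # q)" and x: "x \<notin> set p"
  shows "w @ p @ x # q \<sim> w @ x # p @ q \<and> hypo_equiv (w @ p @ x # q) (w @ x # p @ q)"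
  using assms
proof (induction p arbitrary: q rule: rev_induct)
  case Nil
  then show ?case by (simp add: R_refl)
next
  case (snoc y p)
  have xy: "x \<noteq> y" "x \<notin> set p" using snoc.prems by auto
  have crossed: "crossed i j (w @ x # u) = crossed i j (w @ (p @ [y]) @ x # q)" if "i < j" for i j
    using snoc.prems(2) that by (simp add: hypo_equiv_def)
  have mset: "mset u = mset p + {#y#} + mset q"
    using snoc.prems(2) by (simp add: hypo_equiv_def)
  have set: "set u = insert y (set p \<union> set q)"
    using arg_cong[OF mset, of set_mset] by simp
  have step: "(w @ p) @ [y,x] @ q \<sim> (w @ p) @ [x,y] @ q \<and>
      hypo_equiv ((w @ p) @ [y,x] @ q) ((w @ p) @ [x,y] @ q)"
  proof (cases "x < y")
    case True
    \<comment> \<open>Here \<open>y\<close> precedes \<open>x\<close>, so the pair is also crossed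
      in \<open>w @ x # u\<close>, although \<open>x\<close> comes first after \<open>w\<close>
      there. The cause is a letter between, a \<open>y\<close> in \<open>w\<close>, or a further
      \<open>x\<close>, which must lie in \<open>q\<close> because \<open>p\<close> has
      none.\<close>
    have "(\<exists>b\<in>set (w @ p). x < b \<and> b \<le> y) \<or> (\<exists>b\<in>set q. x \<le> b \<and> b < y)"
    proof (rule ccontr)
      assume neg: "\<not> ?thesis"
      then have *: "y \<notin> set w" "x \<notin> set q" using True by auto
      have "crossed x y (w @ x # u)"
        unfolding crossed[OF True] by simp
      then have "crossed x y w \<or> crossed x y u" using * xy by simp
      moreover have "\<not> crossed x y w" using crossed_imp[OF _ True] neg * by fastforce
      moreover have "\<not> crossed x y u"
        using crossed_imp[OF _ True, of u] neg * xy set by fastforce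
      ultimately show False by simp
    qed
    then show ?thesis
      using snoc.prems(1) True by (intro conjI swap sound_swap) auto
  next
    case False
    then have yx: "y < x" using xy by simp
    \<comment> \<open>In \<open>w @ x # u\<close> the letter \<open>x\<close> precedes
      \<open>y\<close>, so the pair is crossed in the current word too. The neighbours
      \<open>y\<close>, \<open>x\<close> stand in ascending order and cannot be the cause.\<close>
    have "(\<exists>b\<in>set (w @ p). y < b \<and> b \<le> x) \<or> (\<exists>b\<in>set q. y \<le> b \<and> b < x)"
    proof (rule ccontr)
      assume neg: "\<not> ?thesis"
      then have *: "x \<notin> set (w @ p)" "y \<notin> set q" using yx by auto
      have "crossed y x (w @ (p @ [y]) @ x # q)"
        unfolding crossed[OF yx, symmetric] by (simp add: set)
      then have "crossed y x (w @ p) \<or> crossed y x q" using * yx by auto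
      moreover have "\<not> crossed y x (w @ p)" using crossed_imp[OF _ yx, of "w @ p"] neg * by fastforce
      moreover have "\<not> crossed y x q"
        using crossed_imp[OF _ yx, of q] neg * by fastforce
      ultimately show False by simp
    qed
    from swap[OF _ yx this] sound_swap[OF yx this] show ?thesis
      using snoc.prems(1) by (auto intro: R_sym hypo_equiv_sym)
  qed
  have "w @ p @ x # y # q \<sim> w @ x # p @ y # q \<and>
      hypo_equiv (w @ p @ x # y # q) (w @ x # p @ y # q)"
    using snoc.prems step xy by (intro snoc.IH) (auto intro: hypo_equiv_trans)
  then show ?case using step by (auto intro: R_trans hypo_equiv_trans)
qed

lemma complete: "hypo_equiv u v \<Longrightarrow> u \<sim> v"
proof (induction "length u" arbitrary: u v rule: less_induct)
  case less
  \<comment> \<open>The agreed prefix \<open>w\<close> grows letter by letter while the total length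
    stays that of \<open>u\<close>, so completeness for shorter words remains available for every
    exchange.\<close>
  have "w @ s \<sim> w @ t" if "hypo_equiv (w @ s) (w @ t)" "length (w @ s) = length u" for w s t
    using that
  proof (induction s arbitrary: w t)
    case Nil
    then have "t = []" by (simp add: hypo_equiv_def)
    then show ?case by (simp add: R_refl)
  next
    case (Cons x s)
    have mset: "mset (x # s) = mset t" using Cons.prems by (simp add: hypo_equiv_def)
    then have "x \<in> set t" by (metis list.set_intros(1) mset_eq_setD)
    then obtain p q where t: "t = p @ x # q" "x \<notin> set p" by (auto dest: split_list_first)
    have "length t = length (x # s)" using mset by (metis size_mset)
    then have "w @ p @ x # q \<sim> w @ x # p @ q \<and> hypo_equiv (w @ p @ x # q) (w @ x # p @ q)"
      using Cons.prems t by (intro move_left[of w p x q s]) (auto intro: less)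
    moreover from this have "(w @ [x]) @ s \<sim> (w @ [x]) @ p @ q"
      using Cons.prems t by (intro Cons.IH) (auto intro: hypo_equiv_trans)
    ultimately show ?case using t by (auto intro: R_trans R_sym)
  qed
  from this[of "[]"] show ?case using less.prems by simp
qed

end

section \<open>Presentations of the two monoids\<close>

lemma crossed_map:
  "strict_mono f \<Longrightarrow> crossed (f i) (f j) (map f u) = crossed i j u"
  by (induction u) (auto simp: strict_mono_less strict_mono_eq)

lemma presentation_cong_lists:
  "(u, v) \<in> presentation_cong A R \<Longrightarrow> u \<in> lists A \<and> v \<in> lists A"
  by (induction rule: presentation_cong.induct) auto

lemma hypo_equiv_hypoplactic_rels: "(u, v) \<in> hypoplactic_rels A \<Longrightarrow> hypo_equiv u v"
  by (auto simp: hypoplactic_rels_def plactic_rels_def hypo_equiv_def)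

text \<open>The locale speaks of all words over a type, the presentation of words over
  \<open>{1..}\<close>; the shift \<open>Suc\<close> is an order isomorphism between the two
  alphabets.\<close>

lemma hypoplactic_presentation:
  "hypoplactic (\<lambda>u v. (map Suc u, map Suc v) \<in> presentation_cong {1..} (hypoplactic_rels {1..}))"
proof
  let ?C = "presentation_cong {1..} (hypoplactic_rels {1..})"
  note rel = presentation_cong.rel[of _ _ "hypoplactic_rels {1..}" "{1::nat..}"]
  show "(map Suc u, map Suc u) \<in> ?C" for u
    by (rule presentation_cong.refl) auto
  show "(map Suc v, map Suc u) \<in> ?C" if "(map Suc u, map Suc v) \<in> ?C" for u v
    using that by (rule presentation_cong.sym)
  show "(map Suc u, map Suc w) \<in> ?C"
    if "(map Suc u, map Suc v) \<in> ?C" "(map Suc v, map Suc w) \<in> ?C" for u v w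
    using that by (rule presentation_cong.trans)
  show "(map Suc (u @ u'), map Suc (v @ v')) \<in> ?C"
    if "(map Suc u, map Suc v) \<in> ?C" "(map Suc u', map Suc v') \<in> ?C" for u v u' v'
    using presentation_cong.append[OF that] by simp
  fix a b c d :: nat
  show "(map Suc [a,c,b], map Suc [c,a,b]) \<in> ?C" if "a \<le> b" "b < c"
    by (rule rel) (use that in \<open>auto simp: hypoplactic_rels_def plactic_rels_def\<close>)
  show "(map Suc [b,a,c], map Suc [b,c,a]) \<in> ?C" if "a < b" "b \<le> c"
    by (rule rel) (use that in \<open>auto simp: hypoplactic_rels_def plactic_rels_def\<close>)
  show "(map Suc [c,a,d,b], map Suc [a,c,b,d]) \<in> ?C" if "a \<le> b" "b < c" "c \<le> d"
    by (rule rel) (use that in \<open>auto simp: hypoplactic_rels_def\<close>)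
  show "(map Suc [b,d,a,c], map Suc [d,b,c,a]) \<in> ?C" if "a < b" "b \<le> c" "c < d"
    by (rule rel) (use that in \<open>auto simp: hypoplactic_rels_def\<close>)
qed

lemma hypoplactic_cong_iff:
  "(u, v) \<in> presentation_cong {1..} (hypoplactic_rels {1..}) \<longleftrightarrow>
    u \<in> lists {1..} \<and> v \<in> lists {1..} \<and> hypo_equiv u v"
proof (intro iffI conjI)
  assume uv: "(u, v) \<in> presentation_cong {1..} (hypoplactic_rels {1..})"
  then show "u \<in> lists {1..}" "v \<in> lists {1..}"
    by (simp_all add: presentation_cong_lists)
  show "hypo_equiv u v"
    using uv
    by induction (blast intro: hypo_equiv_refl hypo_equiv_hypoplactic_rels hypo_equiv_sym
        hypo_equiv_trans hypo_equiv_append)+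
next
  assume uv: "u \<in> lists {1..} \<and> v \<in> lists {1..} \<and> hypo_equiv u v"
  interpret hypoplactic "\<lambda>u v. (map Suc u, map Suc v) \<in> presentation_cong {1..} (hypoplactic_rels {1..})"
    by (rule hypoplactic_presentation)
  define u' v' where "u' = map (\<lambda>k. k - 1) u" and "v' = map (\<lambda>k. k - 1) v"
  have u: "u = map Suc u'" and v: "v = map Suc v'"
    using uv by (auto simp: u'_def v'_def o_def intro!: map_idI[symmetric])
  have Suc: "crossed (Suc i) (Suc j) (map Suc w) = crossed i j w" for i j w
    by (rule crossed_map) (simp add: strict_mono_Suc_iff)
  have "hypo_equiv u' v'"
    unfolding hypo_equiv_def
  proof (intro conjI allI impI)
    have "mset u = mset v" using uv by (simp add: hypo_equiv_def)
    then show "mset u' = mset v'" by (simp add: u'_def v'_def)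
    fix i j :: nat assume "i < j"
    then have "crossed (Suc i) (Suc j) u = crossed (Suc i) (Suc j) v"
      using uv by (simp add: hypo_equiv_def)
    then show "crossed i j u' = crossed i j v'"
      by (simp only: u v Suc)
  qed
  from complete[OF this] show "(u, v) \<in> presentation_cong {1..} (hypoplactic_rels {1..})"
    by (simp add: u v)
qed

section \<open>Normal forms in \<open>styl\<^sub>2\<close>\<close>

abbreviation styl2_cong :: "(nat list \<times> nat list) set" where
  "styl2_cong \<equiv> presentation_cong {1..2} (stylic_rels {1..2})"

text \<open>On words over \<open>{1, 2}\<close> the values are \<open>[]\<close>,
  \<open>[1]\<close>, \<open>[2]\<close>, \<open>[1,2]\<close>, \<open>[2,1]\<close>, which
  represent the five elements of the monoid.\<close>

definition styl2_normal :: "nat list \<Rightarrow> nat list" where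
  "styl2_normal u = (if crossed 1 2 u then [2,1]
     else (if 1 \<in> set u then [1] else []) @ (if 2 \<in> set u then [2] else []))"

text \<open>Prefixing a letter to a normal form of length two gives 112, 121, 212 or 221.
  Idempotence handles all but 121 and 212, which the cubic relations with a repeated letter turn
  into 211 and 221.\<close>

lemma styl2_cong_normal: "u \<in> lists {1..2} \<Longrightarrow> (u, styl2_normal u) \<in> styl2_cong"
proof (induction u)
  case Nil
  then show ?case by (simp add: styl2_normal_def presentation_cong.refl)
next
  case (Cons x u)
  note rel = presentation_cong.rel[of _ _ "stylic_rels {1..2}" "{1..2::nat}"]
  note intros = presentation_cong.refl[of _ "{1..2::nat}"]
  have append: "(s @ t, s' @ t) \<in> styl2_cong"
    if "(s, s') \<in> styl2_cong" "t \<in> lists {1..2}" for s s' t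
    using that by (intro presentation_cong.append presentation_cong.refl)
  have idem: "([a,a], [a]) \<in> styl2_cong" if "a \<in> {1,2}" for a
    by (rule rel) (use that in \<open>auto simp: stylic_rels_def\<close>)
  have 121: "([1,2,1], [2,1]) \<in> styl2_cong"
  proof (rule presentation_cong.trans)
    show "([1,2,1], [2,1,1]) \<in> styl2_cong"
      by (rule rel) (auto simp: stylic_rels_def plactic_rels_def)
    show "([2,1,1], [2,1]) \<in> styl2_cong"
      using presentation_cong.append[OF intros[of "[2]"] idem[of 1]] by simp
  qed
  have 221: "([2,2,1], [2,1]) \<in> styl2_cong"
    using append[OF idem[of 2], of "[1]"] by simp
  have 212: "([2,1,2], [2,1]) \<in> styl2_cong"
  proof (rule presentation_cong.trans[OF _ 221])
    show "([2,1,2], [2,2,1]) \<in> styl2_cong"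
      by (rule rel) (auto simp: stylic_rels_def plactic_rels_def)
  qed
  have 112: "([1,1,2], [1,2]) \<in> styl2_cong"
    using append[OF idem[of 1], of "[2]"] by simp
  have x: "x = 1 \<or> x = 2" using Cons.prems by auto
  have 12: "1 \<in> set u \<and> 2 \<in> set u" if "crossed 1 2 u" using crossed_imp[OF that] by auto
  have 1: "(x # u, x # styl2_normal u) \<in> styl2_cong"
    using presentation_cong.append[OF intros[of "[x]"] Cons.IH] Cons.prems by simp
  have 2: "(x # styl2_normal u, styl2_normal (x # u)) \<in> styl2_cong"
    using x 12 idem[of 1] idem[of 2] 121 221 212 112 intros[of "[1]"] intros[of "[2]"]
      intros[of "[1,2]"] intros[of "[2,1]"]
    by (auto simp: styl2_normal_def simp del: One_nat_def)
  show ?case by (rule presentation_cong.trans[OF 1 2])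
qed

lemma styl2_cong_iff:
  "(u, v) \<in> styl2_cong \<longleftrightarrow> u \<in> lists {1..2} \<and> v \<in> lists {1..2} \<and>
    set u = set v \<and> crossed 1 2 u = crossed 1 2 v"
proof
  assume uv: "(u, v) \<in> styl2_cong"
  then have "set u = set v \<and> crossed 1 2 u = crossed 1 2 v"
  proof induction
    case (rel u v)
    then show ?case by (auto simp: stylic_rels_def plactic_rels_def)
  qed auto
  with presentation_cong_lists[OF uv]
  show "u \<in> lists {1..2} \<and> v \<in> lists {1..2} \<and> set u = set v \<and> crossed 1 2 u = crossed 1 2 v"
    by blast
next
  assume uv: "u \<in> lists {1..2} \<and> v \<in> lists {1..2} \<and> set u = set v \<and> crossed 1 2 u = crossed 1 2 v"
  then have "styl2_normal u = styl2_normal v" by (simp add: styl2_normal_def)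
  then show "(u, v) \<in> styl2_cong"
    using uv styl2_cong_normal[of u] styl2_cong_normal[of v]
    by (metis presentation_cong.sym presentation_cong.trans)
qed

section \<open>Homomorphisms out of presented monoids\<close>

lemma presented_monoid_hom:
  assumes cong: "\<And>u v. (u, v) \<in> presentation_cong A R \<Longrightarrow> f u = f v"
    and mult: "\<And>u v. u \<in> lists A \<Longrightarrow> v \<in> lists A \<Longrightarrow> f (u @ v) = f u \<otimes>\<^bsub>M\<^esub> f v"
    and closed: "\<And>u. u \<in> lists A \<Longrightarrow> f u \<in> carrier M"
  obtains g where "g \<in> hom (presented_monoid A R) M"
    and "\<And>u. u \<in> lists A \<Longrightarrow> g (presentation_cong A R `` {u}) = f u"
proof
  define g where "g = (\<lambda>X. f (SOME u. u \<in> X))"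
  show g: "g (presentation_cong A R `` {u}) = f u" if "u \<in> lists A" for u
  proof -
    have "u \<in> presentation_cong A R `` {u}" using that by (auto intro: presentation_cong.refl)
    then have "(SOME v. v \<in> presentation_cong A R `` {u}) \<in> presentation_cong A R `` {u}"
      by (rule someI)
    then show ?thesis by (auto simp: g_def dest: cong)
  qed
  show "g \<in> hom (presented_monoid A R) M"
  proof (rule homI)
    fix X assume "X \<in> carrier (presented_monoid A R)"
    then obtain u where u: "u \<in> lists A" "X = presentation_cong A R `` {u}"
      by (auto simp: presented_monoid_def quotient_def)
    then show "g X \<in> carrier M" by (simp add: g closed)
    fix Y assume "Y \<in> carrier (presented_monoid A R)"
    then obtain v where v: "v \<in> lists A" "Y = presentation_cong A R `` {v}"
      by (auto simp: presented_monoid_def quotient_def)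
    have "u @ v \<in> lists A" using u v by simp
    then show "g (X \<otimes>\<^bsub>presented_monoid A R\<^esub> Y) = g X \<otimes>\<^bsub>M\<^esub> g Y"
      using u v by (simp only: presented_monoid_mult g mult)
  qed
qed

lemma presented_monoid_class:
  "u \<in> lists A \<Longrightarrow> presentation_cong A R `` {u} \<in> carrier (presented_monoid A R)"
  by (auto simp: presented_monoid_def quotient_def)

lemma presented_monoid_carrierE:
  assumes "X \<in> carrier (presented_monoid A R)"
  obtains u where "u \<in> lists A" "X = presentation_cong A R `` {u}"
  using assms by (auto simp: presented_monoid_def quotient_def)

lemma hypo_content_hom:
  obtains g where "g \<in> hom hypo (free_comm_monoid {1..})"
    and "\<And>u. u \<in> lists {1..} \<Longrightarrow> g (presentation_cong {1..} (hypoplactic_rels {1..}) `` {u}) = mset u"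
proof (rule presented_monoid_hom[of "{1..}" "hypoplactic_rels {1..}" mset "free_comm_monoid {1..}"])
  show "mset u = mset v" if "(u, v) \<in> presentation_cong {1..} (hypoplactic_rels {1..})" for u v
    using that unfolding hypoplactic_cong_iff hypo_equiv_def by blast
qed (auto simp: hypo_def free_comm_monoid_def intro: that)

text \<open>The letters strictly between \<open>i\<close> and \<open>j\<close> go to the zero \<open>21\<close> of \<open>styl\<^sub>2\<close>, which makes
  the image of \<open>u\<close> detect exactly \<open>crossed i j u\<close>.\<close>

definition styl2_letter :: "nat \<Rightarrow> nat \<Rightarrow> nat \<Rightarrow> nat list" where
  "styl2_letter i j k = (if k = i then [1] else if k = j then [2] else if i < k \<and> k < j then [2,1] else [])"

lemma styl2_letter_lists: "concat (map (styl2_letter i j) u) \<in> lists {1..2}"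
  by (auto simp: styl2_letter_def split: if_splits)

lemma set_styl2_letters:
  assumes "i < j"
  shows "1 \<in> set (concat (map (styl2_letter i j) u)) \<longleftrightarrow> i \<in> set u \<or> (\<exists>k\<in>set u. i < k \<and> k < j)"
    and "2 \<in> set (concat (map (styl2_letter i j) u)) \<longleftrightarrow> j \<in> set u \<or> (\<exists>k\<in>set u. i < k \<and> k < j)"
  using assms by (induction u) (auto simp: styl2_letter_def)

text \<open>A letter strictly between is crossed by its own image \<open>[2,1]\<close>. Without such
  letters, 1 and 2 in the image stem from \<open>i\<close> and \<open>j\<close> alone.\<close>

lemma crossed_styl2_letters:
  "i < j \<Longrightarrow> crossed 1 2 (concat (map (styl2_letter i j) u)) = crossed i j u"
proof (induction u)
  case (Cons k u)
  then show ?case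
    using crossed_between[of _ u i j] set_styl2_letters[OF Cons.prems, of u] by (auto simp: styl2_letter_def)
qed simp

lemma hypo_styl2_hom:
  assumes ij: "i < j"
  obtains g where "g \<in> hom hypo (styl 2)"
    and "\<And>u. u \<in> lists {1..} \<Longrightarrow> g (presentation_cong {1..} (hypoplactic_rels {1..}) `` {u}) =
      styl2_cong `` {concat (map (styl2_letter i j) u)}"
proof (rule presented_monoid_hom[of "{1..}" "hypoplactic_rels {1..}"
      "\<lambda>u. styl2_cong `` {concat (map (styl2_letter i j) u)}" "styl 2"])
  fix u v :: "nat list" assume "(u, v) \<in> presentation_cong {1..} (hypoplactic_rels {1..})"
  then have uv: "hypo_equiv u v" unfolding hypoplactic_cong_iff by blast
  then have "set u = set v" by (auto simp: hypo_equiv_def dest: mset_eq_setD)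
  then have "set (concat (map (styl2_letter i j) u)) = set (concat (map (styl2_letter i j) v))"
    by simp
  then have "(concat (map (styl2_letter i j) u), concat (map (styl2_letter i j) v)) \<in> styl2_cong"
    using uv ij styl2_letter_lists
    by (simp only: styl2_cong_iff crossed_styl2_letters hypo_equiv_def)
  then show "styl2_cong `` {concat (map (styl2_letter i j) u)} =
      styl2_cong `` {concat (map (styl2_letter i j) v)}"
    by (rule equiv_class_eq[OF equiv_presentation_cong])
next
  show "styl2_cong `` {concat (map (styl2_letter i j) (u @ v))} =
      styl2_cong `` {concat (map (styl2_letter i j) u)} \<otimes>\<^bsub>styl 2\<^esub>
      styl2_cong `` {concat (map (styl2_letter i j) v)}" for u v
    unfolding styl_def presented_monoid_mult[OF styl2_letter_lists styl2_letter_lists] by simp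
  show "styl2_cong `` {concat (map (styl2_letter i j) u)} \<in> carrier (styl 2)" for u
    unfolding styl_def by (rule presented_monoid_class[OF styl2_letter_lists])
qed (auto simp: hypo_def intro: that)

lemma hypo_onto_free_comm: "epi hypo (free_comm_monoid {1::nat..}) \<noteq> {}"
proof -
  obtain g where g: "g \<in> hom hypo (free_comm_monoid {1..})"
    "\<And>u. u \<in> lists {1..} \<Longrightarrow> g (presentation_cong {1..} (hypoplactic_rels {1..}) `` {u}) = mset u"
    by (rule hypo_content_hom) blast
  have "m \<in> g ` carrier hypo" if m: "m \<in> carrier (free_comm_monoid {1..})" for m
  proof -
    obtain u where "mset u = m" using ex_mset by blast
    moreover from this have "u \<in> lists {1..}" using m by (auto simp: free_comm_monoid_def)
    ultimately show ?thesis
      using g(2)[of u] presented_monoid_class[of u] unfolding hypo_def by (metis imageI)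
  qed
  then have "g \<in> epi hypo (free_comm_monoid {1..})"
    using g(1) by (auto simp: epi_def hom_def)
  then show ?thesis by blast
qed

text \<open>For the pair 1, 2 no letter lies strictly between: \<open>styl2_letter 1 2\<close> fixes
  1 and 2 and erases the rest, so a word over \<open>{1, 2}\<close> represents a preimage of its own
  class.\<close>

lemma hypo_onto_styl2: "epi hypo (styl 2) \<noteq> {}"
proof -
  obtain g where g: "g \<in> hom hypo (styl 2)"
    "\<And>u. u \<in> lists {1..} \<Longrightarrow> g (presentation_cong {1..} (hypoplactic_rels {1..}) `` {u}) =
      styl2_cong `` {concat (map (styl2_letter 1 2) u)}"
    by (rule hypo_styl2_hom[of 1 2]) auto
  have "X \<in> g ` carrier hypo" if X: "X \<in> carrier (styl 2)" for X
  proof -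
    obtain u where u: "u \<in> lists {1..2}" "X = styl2_cong `` {u}"
      using X unfolding styl_def by (rule presented_monoid_carrierE)
    have "concat (map (styl2_letter 1 2) u) = u"
      using u(1) by (induction u) (auto simp: styl2_letter_def)
    moreover have "u \<in> lists {1..}" using u(1) by auto
    ultimately show ?thesis
      using g(2)[of u] presented_monoid_class[of u] u unfolding hypo_def by (metis imageI)
  qed
  then have "g \<in> epi hypo (styl 2)"
    using g(1) by (auto simp: epi_def hom_def)
  then show ?thesis by blast
qed

text \<open>The unit is carried along because \<open>hom\<close> asks only for multiplicativity,
  whereas an image inside a direct product must contain the unit of the product.\<close>

lemma hypo_separation:
  assumes x: "x \<in> carrier hypo" and y: "y \<in> carrier hypo" and "x \<noteq> y"
  shows "(\<exists>g\<in>hom hypo (free_comm_monoid {1::nat..}).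
        g \<one>\<^bsub>hypo\<^esub> = \<one>\<^bsub>free_comm_monoid {1::nat..}\<^esub> \<and> g x \<noteq> g y) \<or>
      (\<exists>g\<in>hom hypo (styl 2). g \<one>\<^bsub>hypo\<^esub> = \<one>\<^bsub>styl 2\<^esub> \<and> g x \<noteq> g y)"
proof -
  let ?C = "presentation_cong {1..} (hypoplactic_rels {1..})"
  have one: "\<one>\<^bsub>hypo\<^esub> = ?C `` {[]}"
    by (simp add: hypo_def presented_monoid_def)
  obtain u where u: "u \<in> lists {1..}" "x = ?C `` {u}"
    using x unfolding hypo_def by (rule presented_monoid_carrierE)
  obtain v where v: "v \<in> lists {1..}" "y = ?C `` {v}"
    using y unfolding hypo_def by (rule presented_monoid_carrierE)
  have "(u, v) \<notin> ?C"
    using assms(3) u v equiv_class_eq[OF equiv_presentation_cong] by blast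
  then have "mset u \<noteq> mset v \<or> (\<exists>i j. i < j \<and> crossed i j u \<noteq> crossed i j v)"
    using u v unfolding hypoplactic_cong_iff hypo_equiv_def by blast
  then show ?thesis
  proof (elim disjE exE conjE)
    assume "mset u \<noteq> mset v"
    moreover obtain g where g: "g \<in> hom hypo (free_comm_monoid {1..})"
      "\<And>u. u \<in> lists {1..} \<Longrightarrow> g (?C `` {u}) = mset u"
      by (rule hypo_content_hom) blast
    moreover have "g \<one>\<^bsub>hypo\<^esub> = \<one>\<^bsub>free_comm_monoid {1::nat..}\<^esub>"
      using g(2)[of "[]"] by (simp add: one free_comm_monoid_def)
    ultimately have "g \<in> hom hypo (free_comm_monoid {1..}) \<and>
        g \<one>\<^bsub>hypo\<^esub> = \<one>\<^bsub>free_comm_monoid {1::nat..}\<^esub> \<and> g x \<noteq> g y"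
      using u v by simp
    then show ?thesis by blast
  next
    fix i j assume ij: "i < j" and ne: "crossed i j u \<noteq> crossed i j v"
    obtain g where g: "g \<in> hom hypo (styl 2)"
      "\<And>u. u \<in> lists {1..} \<Longrightarrow> g (?C `` {u}) = styl2_cong `` {concat (map (styl2_letter i j) u)}"
      by (rule hypo_styl2_hom[OF ij]) blast
    have "(concat (map (styl2_letter i j) u), concat (map (styl2_letter i j) v)) \<notin> styl2_cong"
      using ne by (simp only: styl2_cong_iff crossed_styl2_letters[OF ij] simp_thms)
    then have "g x \<noteq> g y"
      using u v g(2) eq_equiv_class_iff[OF equiv_presentation_cong styl2_letter_lists styl2_letter_lists]
      by simp
    moreover have "g \<one>\<^bsub>hypo\<^esub> = \<one>\<^bsub>styl 2\<^esub>"
      using g(2)[of "[]"] by (simp add: one styl_def presented_monoid_def)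
    ultimately show ?thesis using g(1) by blast
  qed
qed

section \<open>Membership in varieties\<close>

lemma hom_one:
  assumes M: "monoid M" and N: "monoid N" and f: "f \<in> hom M N" "f ` carrier M = carrier N"
  shows "f \<one>\<^bsub>M\<^esub> = \<one>\<^bsub>N\<^esub>"
proof -
  interpret M: monoid M by (rule M)
  interpret N: monoid N by (rule N)
  obtain x where x: "x \<in> carrier M" "f x = \<one>\<^bsub>N\<^esub>"
    using N.one_closed f(2) by (metis imageE)
  have "f \<one>\<^bsub>M\<^esub> = f \<one>\<^bsub>M\<^esub> \<otimes>\<^bsub>N\<^esub> f x"
    using x hom_in_carrier[OF f(1) M.one_closed] by simp
  also have "\<dots> = f (\<one>\<^bsub>M\<^esub> \<otimes>\<^bsub>M\<^esub> x)"
    using hom_mult[OF f(1) M.one_closed x(1)] by simp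
  finally show ?thesis using x by simp
qed

text \<open>Subdirect embedding: one factor for each pair of distinct elements makes the induced map
  into the product injective.\<close>

lemma monoid_variety_separated:
  fixes N :: "'u::infinite monoid"
  assumes V: "monoid_variety \<V>" and N: "monoid N"
    and sep: "\<And>x y. x \<in> carrier N \<Longrightarrow> y \<in> carrier N \<Longrightarrow> x \<noteq> y \<Longrightarrow>
      \<exists>M\<in>\<V>. \<exists>f\<in>hom N M. f \<one>\<^bsub>N\<^esub> = \<one>\<^bsub>M\<^esub> \<and> f x \<noteq> f y"
  shows "N \<in> \<V>"
proof -
  interpret N: monoid N by (rule N)
  define P where "P = {(x, y). x \<in> carrier N \<and> y \<in> carrier N \<and> x \<noteq> y}"
  have "\<forall>p. \<exists>M f. p \<in> P \<longrightarrow>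
      M \<in> \<V> \<and> f \<in> hom N M \<and> f \<one>\<^bsub>N\<^esub> = \<one>\<^bsub>M\<^esub> \<and> f (fst p) \<noteq> f (snd p)"
  proof
    fix p show "\<exists>M f. p \<in> P \<longrightarrow>
        M \<in> \<V> \<and> f \<in> hom N M \<and> f \<one>\<^bsub>N\<^esub> = \<one>\<^bsub>M\<^esub> \<and> f (fst p) \<noteq> f (snd p)"
      using sep[of "fst p" "snd p"] unfolding P_def by (cases p) (simp, blast)
  qed
  then obtain M f where Mf: "\<And>p. p \<in> P \<Longrightarrow>
      M p \<in> \<V> \<and> f p \<in> hom N (M p) \<and> f p \<one>\<^bsub>N\<^esub> = \<one>\<^bsub>M p\<^esub> \<and> f p (fst p) \<noteq> f p (snd p)"
    by metis
  define g where "g = (\<lambda>x. \<lambda>p\<in>P. f p x)"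
  have g_in: "g x \<in> carrier (product_group P M)" if "x \<in> carrier N" for x
    using Mf that by (auto simp: g_def intro: hom_in_carrier)
  have g_mult: "g (x \<otimes>\<^bsub>N\<^esub> y) = g x \<otimes>\<^bsub>product_group P M\<^esub> g y"
    if "x \<in> carrier N" "y \<in> carrier N" for x y
    using Mf that by (auto simp: g_def hom_mult intro!: restrict_ext)
  have g_one: "g \<one>\<^bsub>N\<^esub> = \<one>\<^bsub>product_group P M\<^esub>"
    using Mf by (auto simp: g_def intro!: restrict_ext)
  have g_inj: "inj_on g (carrier N)"
  proof (rule inj_onI, rule ccontr)
    fix x y assume xy: "x \<in> carrier N" "y \<in> carrier N" "g x = g y" "x \<noteq> y"
    then have p: "(x, y) \<in> P" by (simp add: P_def)
    then have "f (x, y) x = f (x, y) y" using fun_cong[OF xy(3), of "(x, y)"] by (simp add: g_def)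
    then show False using Mf[OF p] by simp
  qed
  have sub: "submonoid (g ` carrier N) (product_group P M)"
  proof
    show "g ` carrier N \<subseteq> carrier (product_group P M)" using g_in by blast
    show "\<one>\<^bsub>product_group P M\<^esub> \<in> g ` carrier N" unfolding g_one[symmetric] by simp
    show "a \<otimes>\<^bsub>product_group P M\<^esub> b \<in> g ` carrier N"
      if "a \<in> g ` carrier N" "b \<in> g ` carrier N" for a b
      using that by (auto simp only: g_mult[symmetric] intro!: imageI N.m_closed)
  qed
  have "g \<in> iso N ((product_group P M)\<lparr>carrier := g ` carrier N\<rparr>)"
    using g_inj g_mult by (simp add: iso_def hom_def bij_betw_def)
  then have "N \<cong> (product_group P M)\<lparr>carrier := g ` carrier N\<rparr>" by (rule is_isoI)
  then show ?thesis
    using Mf by (intro monoid_variety_subproduct[OF V _ sub N]) blast+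
qed

section \<open>Isomorphic copies over the ambient type\<close>

lemma copies_monoid: "K \<in> copies M \<Longrightarrow> monoid K"
  by (simp add: copies_def)

lemma copies_isoE:
  assumes "K \<in> copies M" "monoid M"
  obtains h where "h \<in> hom K M" "bij_betw h (carrier K) (carrier M)" "h \<one>\<^bsub>K\<^esub> = \<one>\<^bsub>M\<^esub>"
  using assms hom_one[of K M] by (auto simp: copies_def is_iso_def iso_def bij_betw_def)

lemma copies_inv_isoE:
  assumes K: "K \<in> copies M" and M: "monoid M"
  obtains h where "h \<in> hom M K" "bij_betw h (carrier M) (carrier K)" "h \<one>\<^bsub>M\<^esub> = \<one>\<^bsub>K\<^esub>"
proof -
  obtain f where f: "f \<in> hom K M" "bij_betw f (carrier K) (carrier M)" "f \<one>\<^bsub>K\<^esub> = \<one>\<^bsub>M\<^esub>"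
    using K M by (rule copies_isoE)
  interpret K: monoid K by (rule copies_monoid[OF K])
  let ?h = "inv_into (carrier K) f"
  have bij: "bij_betw ?h (carrier M) (carrier K)" by (rule bij_betw_inv_into[OF f(2)])
  have "?h \<in> hom M K"
  proof (rule homI)
    show in_K: "?h x \<in> carrier K" if "x \<in> carrier M" for x
      using bij that by (auto simp: bij_betw_def)
    fix x y assume xy: "x \<in> carrier M" "y \<in> carrier M"
    then have "x \<otimes>\<^bsub>M\<^esub> y = f (?h x \<otimes>\<^bsub>K\<^esub> ?h y)"
      using hom_mult[OF f(1) in_K in_K] f(2) by (simp add: bij_betw_inv_into_right)
    then show "?h (x \<otimes>\<^bsub>M\<^esub> y) = ?h x \<otimes>\<^bsub>K\<^esub> ?h y"
      using in_K xy f(2) by (simp add: bij_betw_inv_into_left)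
  qed
  moreover have "?h \<one>\<^bsub>M\<^esub> = \<one>\<^bsub>K\<^esub>"
    using f by (metis bij_betw_inv_into_left K.one_closed)
  ultimately show ?thesis using bij that by blast
qed

lemma copies_hom:
  assumes K: "K \<in> copies M" and M: "monoid M" and f: "f \<in> hom N M" "f \<one>\<^bsub>N\<^esub> = \<one>\<^bsub>M\<^esub>"
    and xy: "x \<in> carrier N" "y \<in> carrier N" "f x \<noteq> f y"
  shows "\<exists>g\<in>hom N K. g \<one>\<^bsub>N\<^esub> = \<one>\<^bsub>K\<^esub> \<and> g x \<noteq> g y"
proof -
  obtain h where h: "h \<in> hom M K" "bij_betw h (carrier M) (carrier K)" "h \<one>\<^bsub>M\<^esub> = \<one>\<^bsub>K\<^esub>"
    using K M by (rule copies_inv_isoE)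
  have "h (f x) \<noteq> h (f y)"
    using h(2) xy hom_in_carrier[OF f(1)] by (auto simp: bij_betw_def inj_on_def)
  then show ?thesis
    using h(3) f(2) by (intro bexI[OF _ hom_compose[OF f(1) h(1)]]) simp
qed

text \<open>The epimorphism links monoids over foreign types and is transported along isomorphisms
  to copies. Nonemptiness supplies a copy to start from; otherwise the inclusion of
  \<open>copies M\<close> would be vacuous.\<close>

lemma copies_epi_subset:
  assumes V: "monoid_variety \<V>" and sub: "copies M \<subseteq> \<V>" and ne: "copies M \<noteq> ({} :: 'u::infinite monoid set)"
    and M: "monoid M" and M': "monoid M'" and epi: "epi M M' \<noteq> {}"
  shows "copies M' \<subseteq> (\<V> :: 'u monoid set)"
proof
  fix K' :: "'u monoid" assume K': "K' \<in> copies M'"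
  obtain K :: "'u monoid" where K: "K \<in> copies M" using ne by blast
  obtain f where f: "f \<in> hom K M" "bij_betw f (carrier K) (carrier M)"
    using K M by (rule copies_isoE)
  obtain g where g: "g \<in> hom M' K'" "bij_betw g (carrier M') (carrier K')"
    using K' M' by (rule copies_inv_isoE)
  obtain e where e: "e \<in> hom M M'" "e ` carrier M = carrier M'"
    using epi by (auto simp: epi_def)
  have "(g \<circ> (e \<circ> f)) ` carrier K = carrier K'"
    unfolding image_comp[symmetric] using f(2) g(2) e(2) by (simp only: bij_betw_def)
  then have "g \<circ> (e \<circ> f) \<in> epi K K'"
    using hom_compose[OF hom_compose[OF f(1) e(1)] g(1)] by (simp add: epi_def)
  then show "K' \<in> \<V>"
    using V sub K copies_monoid[OF K'] by (meson monoid_variety_epi subsetD)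
qed

text \<open>Serves the free commutative monoid on the carrier of an arbitrary commutative monoid,
  which may be uncountable.\<close>

lemma copies_nonempty_inj:
  fixes e :: "'m \<Rightarrow> 'u::infinite"
  assumes M: "monoid M" and e: "inj_on e (carrier M)"
  shows "(copies M :: 'u monoid set) \<noteq> {}"
proof -
  interpret M: monoid M by (rule M)
  define g where "g = the_inv_into (carrier M) e"
  have g: "g (e x) = x" if "x \<in> carrier M" for x
    using that e by (simp add: g_def the_inv_into_f_f)
  define N where "N = \<lparr>carrier = e ` carrier M,
    monoid.mult = (\<lambda>x y. e (g x \<otimes>\<^bsub>M\<^esub> g y)), one = e \<one>\<^bsub>M\<^esub>\<rparr>"
  have "monoid N"
    by (rule monoidI) (auto simp: N_def g M.m_assoc)
  moreover have "g \<in> iso N M"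
    using g e by (auto simp: iso_def hom_def N_def bij_betw_def inj_on_def image_image)
  ultimately show ?thesis by (auto simp: copies_def is_iso_def)
qed

section \<open>Free commutative monoids on arbitrary sets\<close>

lemma inj_list_infinite: "\<exists>f :: 'u::infinite list \<Rightarrow> 'u. inj f"
proof -
  obtain e :: "'u \<times> 'u \<Rightarrow> 'u" where e: "inj e"
    using card_of_Times_same_infinite[OF infinite_UNIV[where 'a = 'u]]
    unfolding card_of_ordIso[symmetric] UNIV_Times_UNIV by (auto simp: bij_betw_def)
  obtain t :: "nat \<Rightarrow> 'u" where t: "inj t"
    using infinite_countable_subset[OF infinite_UNIV] by blast
  \<comment> \<open>Iterated pairing from the arbitrary start value \<open>t 0\<close> is compared
    only between lists of equal length; the length is therefore stored separately through
    \<open>t\<close>.\<close>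
  let ?code = "\<lambda>xs. foldr (\<lambda>x c. e (x, c)) xs (t 0)"
  have "xs = ys" if "length xs = length ys" "?code xs = ?code ys" for xs ys
    using that by (induction xs ys rule: list_induct2) (auto dest: injD[OF e])
  then have "inj (\<lambda>xs. e (t (length xs), ?code xs))"
    by (auto intro!: injI dest!: injD[OF e] injD[OF t])
  then show ?thesis by blast
qed

lemma inj_multiset_infinite: "\<exists>f :: 'u::infinite multiset \<Rightarrow> 'u. inj f"
proof -
  obtain f :: "'u list \<Rightarrow> 'u" where "inj f" using inj_list_infinite by blast
  moreover have "inj (\<lambda>m :: 'u multiset. SOME xs. mset xs = m)"
    by (rule injI) (metis (mono_tags) ex_mset someI_ex)
  ultimately show ?thesis using inj_compose by blast
qed

lemma comm_monoid_image_of_free: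
  assumes "comm_monoid M"
  shows "epi (free_comm_monoid (carrier M)) M \<noteq> {}"
proof -
  interpret M: comm_monoid M by (rule assms)
  define f where "f m = finprod M (\<lambda>a. a [^]\<^bsub>M\<^esub> count m a) (set_mset m)" for m
  \<comment> \<open>Exponents vanish off the support, so the product may run over any larger finite
    set. This gives \<open>m\<close>, \<open>n\<close> and \<open>m + n\<close> a common index
    set.\<close>
  have f: "f m = finprod M (\<lambda>a. a [^]\<^bsub>M\<^esub> count m a) A"
    if "set_mset m \<subseteq> A" "A \<subseteq> carrier M" "finite A" for m A
    unfolding f_def using that
    by (intro M.finprod_mono_neutral_cong_left) (auto simp: not_in_iff)
  have "f (m + n) = f m \<otimes>\<^bsub>M\<^esub> f n" if "set_mset m \<subseteq> carrier M" "set_mset n \<subseteq> carrier M" for m n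
  proof -
    let ?A = "set_mset m \<union> set_mset n"
    have "f (m + n) = finprod M (\<lambda>a. a [^]\<^bsub>M\<^esub> count (m + n) a) ?A"
      using that by (intro f) auto
    also have "\<dots> = finprod M (\<lambda>a. a [^]\<^bsub>M\<^esub> count m a \<otimes>\<^bsub>M\<^esub> a [^]\<^bsub>M\<^esub> count n a) ?A"
      using that by (intro M.finprod_cong') (auto simp: M.nat_pow_mult)
    also have "\<dots> = finprod M (\<lambda>a. a [^]\<^bsub>M\<^esub> count m a) ?A \<otimes>\<^bsub>M\<^esub> finprod M (\<lambda>a. a [^]\<^bsub>M\<^esub> count n a) ?A"
      using that by (intro M.finprod_multf) auto
    also have "\<dots> = f m \<otimes>\<^bsub>M\<^esub> f n"
      using that f[of m ?A] f[of n ?A] by simp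
    finally show ?thesis .
  qed
  moreover have "f m \<in> carrier M" if "set_mset m \<subseteq> carrier M" for m
    unfolding f_def using that by (intro M.finprod_closed) auto
  ultimately have "f \<in> hom (free_comm_monoid (carrier M)) M"
    by (simp add: hom_def free_comm_monoid_def)
  moreover have "x \<in> f ` carrier (free_comm_monoid (carrier M))" if "x \<in> carrier M" for x
  proof
    show "x = f {#x#}" using that by (simp add: f_def)
    show "{#x#} \<in> carrier (free_comm_monoid (carrier M))"
      using that by (simp add: free_comm_monoid_def)
  qed
  ultimately have "f \<in> epi (free_comm_monoid (carrier M)) M"
    unfolding epi_iff_subset by blast
  then show ?thesis by blast
qed

lemma copies_free_comm_monoid_nonempty:
  "(copies (free_comm_monoid (A :: 'a::countable set)) :: 'u::infinite monoid set) \<noteq> {}"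
proof (rule copies_nonempty)
  show "monoid (free_comm_monoid A)"
    by (rule comm_monoid.axioms(1)[OF comm_monoid_free_comm_monoid])
  have "range mset = (UNIV :: 'a multiset set)" unfolding surj_def by (metis ex_mset)
  then have "countable (UNIV :: 'a multiset set)"
    by (metis countable_image countableI_type)
  then show "countable (carrier (free_comm_monoid A))"
    by (rule countable_subset[OF subset_UNIV])
qed

lemma copies_commutative:
  assumes M: "comm_monoid M"
  shows "copies M \<subseteq> commutative_monoids"
proof
  fix K assume K: "K \<in> copies M"
  interpret M: comm_monoid M by (rule M)
  interpret K: monoid K by (rule copies_monoid[OF K])
  obtain h where h: "h \<in> hom K M" "bij_betw h (carrier K) (carrier M)"
    using K M.monoid_axioms by (rule copies_isoE)
  have "comm_monoid K"
  proof (rule K.monoid_comm_monoidI)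
    fix x y assume xy: "x \<in> carrier K" "y \<in> carrier K"
    then have "h (x \<otimes>\<^bsub>K\<^esub> y) = h (y \<otimes>\<^bsub>K\<^esub> x)"
      using hom_in_carrier[OF h(1)] by (simp add: hom_mult[OF h(1)] M.m_comm)
    then show "x \<otimes>\<^bsub>K\<^esub> y = y \<otimes>\<^bsub>K\<^esub> x"
      using h(2) xy by (auto simp: bij_betw_def inj_on_def)
  qed
  then show "K \<in> commutative_monoids" by (simp add: commutative_monoids_def)
qed

lemma commutative_monoids_subset:
  fixes \<V> :: "'u::infinite monoid set"
  assumes V: "monoid_variety \<V>" and sub: "copies (free_comm_monoid {1::nat..}) \<subseteq> \<V>"
  shows "commutative_monoids \<subseteq> \<V>"
proof
  fix M :: "'u monoid" assume "M \<in> commutative_monoids"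
  then have M: "comm_monoid M" by (simp add: commutative_monoids_def)
  let ?F = "free_comm_monoid (carrier M)" and ?G = "free_comm_monoid {1::nat..}"
  have mon_F: "monoid ?F" and mon_G: "monoid ?G"
    by (rule comm_monoid.axioms(1)[OF comm_monoid_free_comm_monoid])+
  obtain G :: "'u monoid" where G: "G \<in> copies ?G"
    using copies_free_comm_monoid_nonempty by blast
  have "copies ?F \<subseteq> \<V>"
  proof
    fix K :: "'u monoid" assume K: "K \<in> copies ?F"
    obtain h where h: "h \<in> hom K ?F" "bij_betw h (carrier K) (carrier ?F)" "h \<one>\<^bsub>K\<^esub> = \<one>\<^bsub>?F\<^esub>"
      using K mon_F by (rule copies_isoE)
    show "K \<in> \<V>"
    proof (rule monoid_variety_separated[OF V copies_monoid[OF K]])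
      fix x y assume xy: "x \<in> carrier K" "y \<in> carrier K" "x \<noteq> y"
      then have "h x \<noteq> h y" using h(2) by (auto simp: bij_betw_def inj_on_def)
      then obtain a where a: "count (h x) a \<noteq> count (h y) a" by (meson multiset_eqI)
      \<comment> \<open>The additive monoid of natural numbers sits in \<open>?G\<close> as the
        multiples of the generator 1; \<open>c\<close> counts the letter \<open>a\<close> at which
        the two multisets differ.\<close>
      define c where "c m = replicate_mset (count m a) (1::nat)" for m
      have "c \<in> hom ?F ?G"
        by (auto simp: hom_def free_comm_monoid_def c_def multiset_eq_iff)
      then have "c \<circ> h \<in> hom K ?G" by (rule hom_compose[OF h(1)])
      moreover have "(c \<circ> h) \<one>\<^bsub>K\<^esub> = \<one>\<^bsub>?G\<^esub>"
        by (simp add: h(3) c_def free_comm_monoid_def)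
      moreover have "(c \<circ> h) x \<noteq> (c \<circ> h) y"
        using a by (auto simp: c_def dest: arg_cong[of _ _ size])
      ultimately show "\<exists>M\<in>\<V>. \<exists>f\<in>hom K M. f \<one>\<^bsub>K\<^esub> = \<one>\<^bsub>M\<^esub> \<and> f x \<noteq> f y"
        using copies_hom[OF G mon_G _ _ xy(1,2)] G sub by blast
    qed
  qed
  moreover have "copies ?F \<noteq> ({} :: 'u monoid set)"
    using inj_multiset_infinite copies_nonempty_inj[OF mon_F] by (metis inj_on_subset subset_UNIV)
  moreover have "monoid M" using M by (rule comm_monoid.axioms(1))
  moreover have "M \<in> copies M"
    using \<open>monoid M\<close> iso_set_refl by (auto simp: copies_def is_iso_def)
  ultimately show "M \<in> \<V>"
    using copies_epi_subset[OF V _ _ mon_F _ comm_monoid_image_of_free[OF M]] by blast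
qed

lemma monoid_styl: "monoid (styl n)" and monoid_hypo: "monoid hypo"
  unfolding styl_def hypo_def by (rule monoid_presented_monoid)+

lemma copies_presented_monoid_nonempty:
  fixes A :: "'a::countable set"
  shows "(copies (presented_monoid A R) :: 'u::infinite monoid set) \<noteq> {}"
proof (rule copies_nonempty[OF monoid_presented_monoid])
  have "carrier (presented_monoid A R) = (\<lambda>u. presentation_cong A R `` {u}) ` lists A"
    by (auto simp: presented_monoid_def quotient_def)
  then show "countable (carrier (presented_monoid A R))" by simp
qed

lemma variety_generated_superset: "\<K> \<subseteq> variety_generated \<K>"
  by (auto simp: variety_generated_def)

theorem corollary4p5:
  "(variety_of hypo :: 'u::infinite monoid set) =
     variety_join (variety_of (styl 2)) commutative_monoids \<and>
   (variety_of hypo :: 'u monoid set) =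
     variety_generated (copies (styl 2) \<union> copies (free_comm_monoid {1::nat..}))"
proof -
  let ?G = "free_comm_monoid {1::nat..}"
  let ?K = "copies (styl 2) \<union> copies ?G :: 'u monoid set"
  let ?J = "variety_join (variety_of (styl 2)) commutative_monoids :: 'u monoid set"
  have mon_G: "monoid ?G"
    by (rule comm_monoid.axioms(1)[OF comm_monoid_free_comm_monoid])
  have K: "monoid_variety (variety_generated ?K)"
    by (rule monoid_variety_generated) (auto dest: copies_monoid)
  have styl: "monoid_variety (variety_of (styl 2) :: 'u monoid set)"
    unfolding variety_of_def by (rule monoid_variety_generated) (auto dest: copies_monoid)
  have hypo: "monoid_variety (variety_of hypo :: 'u monoid set)"
    unfolding variety_of_def by (rule monoid_variety_generated) (auto dest: copies_monoid)
  have J: "monoid_variety ?J"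
    unfolding variety_join_def
    using monoid_variety_monoid[OF styl] monoid_variety_monoid[OF monoid_variety_commutative_monoids]
    by (intro monoid_variety_generated) blast
  have ne_hypo: "(copies hypo :: 'u monoid set) \<noteq> {}" and ne_styl: "(copies (styl 2) :: 'u monoid set) \<noteq> {}"
    unfolding hypo_def styl_def by (rule copies_presented_monoid_nonempty)+
  have copies_hypo: "copies hypo \<subseteq> (variety_of hypo :: 'u monoid set)"
    unfolding variety_of_def by (rule variety_generated_superset)
  have "variety_generated ?K \<subseteq> variety_of hypo"
    using copies_epi_subset[OF hypo copies_hypo ne_hypo monoid_hypo monoid_styl hypo_onto_styl2]
      copies_epi_subset[OF hypo copies_hypo ne_hypo monoid_hypo mon_G hypo_onto_free_comm]
    by (intro variety_generated_least[OF hypo]) simp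
  moreover have "variety_of hypo \<subseteq> variety_generated ?K"
    unfolding variety_of_def[of hypo]
  proof (rule variety_generated_least[OF K], rule subsetI)
    \<comment> \<open>A single copy of each generator suffices as a target, since every separating
      map can be continued by an isomorphism onto it.\<close>
    obtain S G :: "'u monoid" where S: "S \<in> copies (styl 2)" and G: "G \<in> copies ?G"
      using ne_styl copies_free_comm_monoid_nonempty by blast
    then have SG: "S \<in> variety_generated ?K" "G \<in> variety_generated ?K"
      using variety_generated_superset[of ?K] by blast+
    fix N :: "'u monoid" assume N: "N \<in> copies hypo"
    obtain h where h: "h \<in> hom N hypo" "bij_betw h (carrier N) (carrier hypo)" "h \<one>\<^bsub>N\<^esub> = \<one>\<^bsub>hypo\<^esub>"
      using N monoid_hypo by (rule copies_isoE)
    show "N \<in> variety_generated ?K"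
    proof (rule monoid_variety_separated[OF K copies_monoid[OF N]])
      fix x y assume xy: "x \<in> carrier N" "y \<in> carrier N" "x \<noteq> y"
      then have hxy: "h x \<in> carrier hypo" "h y \<in> carrier hypo" "h x \<noteq> h y"
        using h(2) by (auto simp: bij_betw_def inj_on_def)
      from hypo_separation[OF this]
      have "(\<exists>g\<in>hom N G. g \<one>\<^bsub>N\<^esub> = \<one>\<^bsub>G\<^esub> \<and> g x \<noteq> g y) \<or> (\<exists>g\<in>hom N S. g \<one>\<^bsub>N\<^esub> = \<one>\<^bsub>S\<^esub> \<and> g x \<noteq> g y)"
      proof (elim disjE bexE conjE)
        fix g assume g: "g \<in> hom hypo ?G" "g \<one>\<^bsub>hypo\<^esub> = \<one>\<^bsub>?G\<^esub>" "g (h x) \<noteq> g (h y)"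
        show ?thesis
          by (rule disjI1, rule copies_hom[OF G mon_G hom_compose[OF h(1) g(1)]])
            (use g h(3) xy in auto)
      next
        fix g assume g: "g \<in> hom hypo (styl 2)" "g \<one>\<^bsub>hypo\<^esub> = \<one>\<^bsub>styl 2\<^esub>" "g (h x) \<noteq> g (h y)"
        show ?thesis
          by (rule disjI2, rule copies_hom[OF S monoid_styl hom_compose[OF h(1) g(1)]])
            (use g h(3) xy in auto)
      qed
      then show "\<exists>M\<in>variety_generated ?K. \<exists>f\<in>hom N M. f \<one>\<^bsub>N\<^esub> = \<one>\<^bsub>M\<^esub> \<and> f x \<noteq> f y"
        using SG by blast
    qed
  qed
  ultimately have 1: "variety_of hypo = variety_generated ?K" by (rule equalityI[rotated])
  \<comment> \<open>Only generators need comparing: all commutative monoids are recovered from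
    \<open>?G\<close>, which is itself commutative.\<close>
  have "?J \<subseteq> variety_generated ?K"
    unfolding variety_join_def
  proof (rule variety_generated_least[OF K], rule Un_least)
    show "variety_of (styl 2) \<subseteq> variety_generated ?K"
      unfolding variety_of_def
      using variety_generated_superset[of ?K] by (intro variety_generated_least[OF K]) blast
    show "commutative_monoids \<subseteq> variety_generated ?K"
      using variety_generated_superset[of ?K] by (intro commutative_monoids_subset[OF K]) blast
  qed
  moreover have "variety_generated ?K \<subseteq> ?J"
  proof (rule variety_generated_least[OF J], rule Un_least)
    show "copies (styl 2) \<subseteq> ?J"
      using variety_generated_superset unfolding variety_join_def variety_of_def by blast
    have "copies ?G \<subseteq> (commutative_monoids :: 'u monoid set)"
      by (rule copies_commutative[OF comm_monoid_free_comm_monoid])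
    then show "copies ?G \<subseteq> ?J"
      using variety_generated_superset unfolding variety_join_def by blast
  qed
  ultimately show ?thesis using 1 by auto
qed

end
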